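(* Let $D\subset\mathbb{C}$ be a bounded simply connected John domain and let $Y$ be a weak tangent of $\partial D$. The following statements are true. (1) Every $D$-component of $\mathbb{C}\setminus Y$ is unbounded and simply connected. (2) Every connected component of $Y$ is unbounded. (3) $Y$ is equal to the union of the boundaries of the $D$-components of $\mathbb{C}\setminus Y$. (4) The number of $D$-components of $\mathbb{C}\setminus Y$ is bounded, quantitatively: if $D$ is an $A$-John domain, this number is at most a constant depending only on $A$. (5) The number of connected components of $Y$ is bounded, quantitatively: if $D$ is an $A$-John domain, this number is at most a constant depending only on $A$.
   Context: $\ell(\gamma)$ denotes the length of a curve $\gamma$ (a continuous map from a compact interval). John domains: let $D\subset\mathbb{C}$ be a domain (possibly unbounded) and $A\ge 1$. $D$ is an $A$-John domain if for every pair of distinct points $a,b\in D$ there is a curve $\gamma\colon[0,1]\to D$ with $\gamma(0)=a$, $\gamma(1)=b$ and $\min\{\ell(\gamma|_{[0,t]}),\ell(\gamma|_{[t,1]})\}\le A\,\mathrm{dist}(\gamma(t),\partial D)$ for all $t\in[0,1]$. $D$ is a John domain if it is an $A$-John domain for some $A\ge1$. Local Hausdorff convergence: $B(a,R)$ is the open ball and $N_\varepsilon(E)$ is the open $\varepsilon$-neighborhood of $E$. Closed sets $Y_n\subset\mathbb{C}$ converge to a closed set $Y\subset\mathbb{C}$ in the local Hausdorff sense if for each $z_0\in\mathbb{C}$ and all $R,\varepsilon>0$ there is $N\in\mathbb{N}$ such that for all $n\ge N$: $Y_n\cap B(z_0,R-\varepsilon)\subset N_\varepsilon(Y\cap B(z_0,R))$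 and $Y\cap B(z_0,R-\varepsilon)\subset N_\varepsilon(Y_n\cap B(z_0,R))$. Weak tangents: a closed set $Y\subset\mathbb{C}$ is a weak tangent of a closed set $X\subset\mathbb{C}$ if there are points $p_n\in X$ and scales $\lambda_n>0$ with $\lambda_n\to0$ such that the sets $X_n=(X-p_n)/\lambda_n$ converge to $Y$ in the local Hausdorff sense. $D$-components: let $Y$ be a weak tangent of $\partial D$ arising from sequences $p_n\in\partial D$, $\lambda_n\to0$, and set $D_n=(D-p_n)/\lambda_n$. A connected component $U$ of $\mathbb{C}\setminus Y$ is a $D$-component if there exists $z\in U$ such that $z\in D_n$ for infinitely many $n$. The weak tangent and its $D$-components depend on the sequences $p_n,\lambda_n$. *)

theory Defs
  imports "HOL-Analysis.Analysis"
begin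

definition curve_length :: "(real \<Rightarrow> complex) \<Rightarrow> real \<Rightarrow> real \<Rightarrow> ennreal" where
  "curve_length \<gamma> a b =
     (SUP (n, t) \<in> {(n :: nat, t :: nat \<Rightarrow> real). mono_on {..n} t \<and> t ` {..n} \<subseteq> {a..b}}.
        \<Sum>i<n. ennreal (dist (\<gamma> (t i)) (\<gamma> (t (Suc i)))))"

text \<open>Unlike \<^const>\<open>infdist\<close>, the distance to the empty set is infinite here; this matters
  for the boundary of the whole plane.\<close>

definition dist_to_set :: "complex \<Rightarrow> complex set \<Rightarrow> ennreal" where
  "dist_to_set z E = (INF w \<in> E. ennreal (dist z w))"

definition plane_domain :: "complex set \<Rightarrow> bool" where
  "plane_domain D \<longleftrightarrow> open D \<and> connected D \<and> D \<noteq> {}"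

definition John_domain_const :: "real \<Rightarrow> complex set \<Rightarrow> bool" where
  "John_domain_const A D \<longleftrightarrow> A \<ge> 1 \<and> plane_domain D \<and>
     (\<forall>a\<in>D. \<forall>b\<in>D. a \<noteq> b \<longrightarrow>
        (\<exists>\<gamma>. path \<gamma> \<and> path_image \<gamma> \<subseteq> D \<and> pathstart \<gamma> = a \<and> pathfinish \<gamma> = b \<and>
             (\<forall>t\<in>{0..1}. min (curve_length \<gamma> 0 t) (curve_length \<gamma> t 1)
                            \<le> ennreal A * dist_to_set (\<gamma> t) (frontier D))))"

definition John_domain :: "complex set \<Rightarrow> bool" where
  "John_domain D \<longleftrightarrow> (\<exists>A. John_domain_const A D)"

definition open_nbhd :: "real \<Rightarrow> complex set \<Rightarrow> complex set" where
  "open_nbhd \<epsilon> E = (\<Union>w\<in>E. ball w \<epsilon>)"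

definition local_Hausdorff_lim :: "(nat \<Rightarrow> complex set) \<Rightarrow> complex set \<Rightarrow> bool" where
  "local_Hausdorff_lim Ys Y \<longleftrightarrow> (\<forall>n. closed (Ys n)) \<and> closed Y \<and>
     (\<forall>z0. \<forall>R>0. \<forall>\<epsilon>>0. \<exists>N. \<forall>n\<ge>N.
        Ys n \<inter> ball z0 (R - \<epsilon>) \<subseteq> open_nbhd \<epsilon> (Y \<inter> ball z0 R) \<and>
        Y \<inter> ball z0 (R - \<epsilon>) \<subseteq> open_nbhd \<epsilon> (Ys n \<inter> ball z0 R))"

definition blow_up :: "complex set \<Rightarrow> complex \<Rightarrow> real \<Rightarrow> complex set" where
  "blow_up X p r = (\<lambda>z. (z - p) / of_real r) ` X"

text \<open>Weak tangents are recorded together with the base points and scales they arise from,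
  since the D-components of the complement depend on these data.\<close>

definition weak_tangent_along ::
  "complex set \<Rightarrow> (nat \<Rightarrow> complex) \<Rightarrow> (nat \<Rightarrow> real) \<Rightarrow> complex set \<Rightarrow> bool" where
  "weak_tangent_along X p r Y \<longleftrightarrow> closed X \<and> (\<forall>n. p n \<in> X) \<and> (\<forall>n. r n > 0) \<and> r \<longlonglongrightarrow> 0 \<and>
     local_Hausdorff_lim (\<lambda>n. blow_up X (p n) (r n)) Y"

definition D_components ::
  "complex set \<Rightarrow> (nat \<Rightarrow> complex) \<Rightarrow> (nat \<Rightarrow> real) \<Rightarrow> complex set \<Rightarrow> complex set set" where
  "D_components D p r Y =
     {U \<in> components (- Y). \<exists>z\<in>U. \<exists>\<^sub>\<infinity>n. z \<in> blow_up D (p n) (r n)}"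

end

(* A point w of a John curve from a to b has distance at least min(|w - a|, |w - b|) / A from the
   boundary, and this is all that is used: the condition is invariant under similarities, so it holds with the
   same A on all blow-ups D_n.

   If z lies in a D-component U and in D_n, a John curve from z to a point of D_n far away cannot
   leave U in a bounded region, since there the boundary of D_n is close to Y. Hence U contains, for
   every large R, a ball of radius R / (4 A) centred on the circle of radius R. So U is unbounded, and
   comparing areas in the disc of radius 2 R bounds the number of D-components by 64 A^2.

   The boundary of each D-component U turns out to be connected, which bounds the number of
   components of Y by the number of D-components. Otherwise the complement of U splits near the
   origin into two parts, and so does the complement of D_n in a disc of fixed large radius R. A
   short crosscut of D_n joins the two parts. By Janiszewski's theorem both sides of the crosscut
   leave the disc, so a John curve between far points on the two sides has to cross the crosscut,
   where it is far from both end points but close to the boundary. *)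

theory Submission
  imports Defs "HOL-Complex_Analysis.Complex_Analysis"
begin

section \<open>Crosscuts of simply connected domains\<close>

text \<open>A path in \<open>D\<close> off the horizontal segment would close up, along the vertical
  segment, to a loop in \<open>D\<close> that meets the horizontal segment only at 0. Simple
  connectivity makes its winding numbers about -1 and 1 vanish, but a single crossing makes them
  differ.\<close>

lemma crosscut_separates_standard:
  fixes D :: "complex set"
  assumes "open D" "simply_connected D" "- 1 \<notin> D" "1 \<notin> D"
    and \<delta>: "0 < \<delta>" "\<delta> < 1"
    and vert: "closed_segment (Complex 0 \<delta>) (Complex 0 (- \<delta>)) \<subseteq> D"
  shows "\<not> connected_component (D - closed_segment (- 1) 1) (Complex 0 \<delta>) (Complex 0 (- \<delta>))"
proof
  define u where "u = Complex 0 \<delta>"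
  define v where "v = Complex 0 (- \<delta>)"
  define a where "a = Complex (- 2 * \<delta>) 0"
  define p where "p = Complex (- \<delta>) 0"
  define q where "q = Complex \<delta> 0"
  note defs = u_def v_def a_def p_def q_def
  let ?\<sigma> = "closed_segment (- 1) (1::complex)"
  assume "connected_component (D - ?\<sigma>) (Complex 0 \<delta>) (Complex 0 (- \<delta>))"
  moreover have "open (D - ?\<sigma>)"
    using \<open>open D\<close> by (simp add: open_Diff)
  ultimately have "path_component (D - ?\<sigma>) v u"
    unfolding defs by (metis open_path_connected_component path_component_sym)
  then obtain g where g: "path g" "path_image g \<subseteq> D - ?\<sigma>" "pathstart g = v" "pathfinish g = u"
    by (auto simp: path_component_def)
  have in_seg: "z \<in> ?\<sigma>" if "Im z = 0" "\<bar>Re z\<bar> \<le> 1" for z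
    unfolding closed_segment_def using that
    by (auto intro!: exI[of _ "(1 + Re z) / 2"] simp: complex_eq_iff field_simps)
  have uv: "Re z = 0" if "z \<in> closed_segment u v" for z
    using that by (auto simp: closed_segment_def defs)
  have ua: "Re z \<le> 0 \<and> (Im z = 0 \<longrightarrow> Re z = - 2 * \<delta>)" if "z \<in> closed_segment u a" for z
    using that \<delta> by (auto simp: closed_segment_def defs)
  have av: "Re z \<le> 0 \<and> (Im z = 0 \<longrightarrow> Re z = - 2 * \<delta>)" if "z \<in> closed_segment a v" for z
    using that \<delta> by (auto simp: closed_segment_def defs)
  have pq: "Im z = 0 \<and> \<bar>Re z\<bar> \<le> \<delta>" if "z \<in> closed_segment p q" for z
    using that \<delta> by (auto simp: closed_segment_same_Im closed_segment_eq_real_ivl defs split: if_splits)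
  have ends: "Im z = 0 \<and> \<bar>Re z\<bar> \<le> 1 \<and> \<bar>Re z\<bar> \<ge> \<delta>"
    if "z \<in> closed_segment (- 1) p \<or> z \<in> closed_segment q 1" for z
    using that \<delta> by (auto simp: closed_segment_same_Im closed_segment_eq_real_ivl defs split: if_splits)
  (* The loop \<gamma>1 lies in D, so its winding numbers about -1 and 1, hence about p and q, vanish.
     The loop \<gamma>2 does not separate p from q, but differs from \<gamma>1 by the triangle T, which winds
     around p only. *)
  define \<gamma>1 where "\<gamma>1 = g +++ linepath u v"
  define \<gamma>2 where "\<gamma>2 = g +++ (linepath u a +++ linepath a v)"
  define T where "T = linepath u a +++ linepath a v +++ linepath v u"
  have \<gamma>1: "path \<gamma>1" "pathstart \<gamma>1 = v" "pathfinish \<gamma>1 = v"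
    "path_image \<gamma>1 = path_image g \<union> closed_segment u v"
    using g by (auto simp: \<gamma>1_def path_image_join)
  have \<gamma>2: "path \<gamma>2" "pathstart \<gamma>2 = v" "pathfinish \<gamma>2 = v"
    "path_image \<gamma>2 = path_image g \<union> (closed_segment u a \<union> closed_segment a v)"
    using g by (auto simp: \<gamma>2_def path_image_join)
  have "path_image \<gamma>1 \<subseteq> D"
    using \<gamma>1 g vert by (auto simp: u_def v_def)
  then have zero: "winding_number \<gamma>1 z = 0" if "z \<notin> D" for z
    using simply_connected_imp_winding_number_zero[OF \<open>simply_connected D\<close>] \<gamma>1 that by blast
  have "winding_number \<gamma>1 p = winding_number \<gamma>1 (- 1)"
    by (rule winding_number_eq[where S = "closed_segment (- 1) p"])
      (use \<gamma>1 g ends in_seg uv \<delta> in fastforce)+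
  then have p1: "winding_number \<gamma>1 p = 0"
    using zero \<open>- 1 \<notin> D\<close> by simp
  have "winding_number \<gamma>1 q = winding_number \<gamma>1 1"
    by (rule winding_number_eq[where S = "closed_segment q 1"])
      (use \<gamma>1 g ends in_seg uv \<delta> in fastforce)+
  then have q1: "winding_number \<gamma>1 q = 0"
    using zero \<open>1 \<notin> D\<close> by simp
  have pq2: "winding_number \<gamma>2 p = winding_number \<gamma>2 q"
    by (rule winding_number_eq[where S = "closed_segment p q"])
      (use \<gamma>2 g pq in_seg ua av \<delta> in fastforce)+
  have diff: "winding_number \<gamma>2 z = winding_number \<gamma>1 z + winding_number T z" if "z = p \<or> z = q" for z
  proof -
    have z: "z \<notin> path_image g" "z \<notin> closed_segment u v" "z \<notin> closed_segment v u"
      "z \<notin> closed_segment u a" "z \<notin> closed_segment a v"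
      using that g(2) in_seg[of z] uv[of z] ua[of z] av[of z] \<delta>
      by (auto simp: defs closed_segment_commute)
    have "winding_number (linepath v u) z = - winding_number (linepath u v) z"
      using winding_number_reversepath[of "linepath u v" z] z by simp
    then show ?thesis
      unfolding \<gamma>1_def \<gamma>2_def T_def using g z
      by (simp add: winding_number_join path_image_join)
  qed
  have "winding_number T p \<noteq> 0"
  proof -
    have "\<not> collinear {u, a, v}"
      using \<delta> by (simp add: collinear_3_expand defs complex_eq_iff)
    note * = interior_convex_hull_3_minimal[OF this DIM_complex]
    \<comment> \<open>Barycentric coordinates: \<open>p\<close> is
      \<open>u / 4 + a / 2 + v / 4\<close>.\<close>
    have "p \<in> interior (convex hull {u, a, v})"
      unfolding * mem_Collect_eq
      by (rule exI[of _ "1/4"], rule exI[of _ "1/2"], rule exI[of _ "1/4"]) (auto simp: complex_eq_iff defs)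
    then show ?thesis
      unfolding T_def by (simp add: winding_number_triangle)
  qed
  moreover have "winding_number T q = 0"
    unfolding T_def
    by (rule winding_number_zero_outside[where s = "{z. Re z \<le> 0}"])
      (use \<delta> in \<open>auto simp: defs path_image_join convex_halfspace_Re_le closed_segment_def\<close>)
  ultimately show False
    using diff p1 q1 pq2 by simp
qed

text \<open>Janiszewski's theorem: \<open>P\<close> with the left half of the segment and
  \<open>Q\<close> with the right half are compact sets meeting only in 0. Neither separates the two
  points, since a short detour around 0 on the opposite side joins them, so the union does not
  separate them either.\<close>

lemma crosscut_sides_standard:
  fixes D P Q :: "complex set"
  assumes "compact P" "compact Q" "P \<inter> Q = {}" "P \<inter> D = {}" "Q \<inter> D = {}" "- 1 \<in> P" "1 \<in> Q"
    and seg: "open_segment (- 1) 1 \<subseteq> D"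
    and \<delta>: "0 < \<delta>" and ball: "ball 0 (2 * \<delta>) \<subseteq> D"
  shows "connected_component (- (P \<union> Q \<union> closed_segment (- 1) 1)) (Complex 0 \<delta>) (Complex 0 (- \<delta>))"
proof -
  define u where "u = Complex 0 \<delta>"
  define v where "v = Complex 0 (- \<delta>)"
  have I: "z \<in> closed_segment (- 1) 0 \<longleftrightarrow> Im z = 0 \<and> - 1 \<le> Re z \<and> Re z \<le> 0"
    "z \<in> closed_segment 0 1 \<longleftrightarrow> Im z = 0 \<and> 0 \<le> Re z \<and> Re z \<le> 1"
    "z \<in> open_segment (- 1) 1 \<longleftrightarrow> Im z = 0 \<and> - 1 < Re z \<and> Re z < 1"
    "z \<in> closed_segment (- 1) 1 \<longleftrightarrow> Im z = 0 \<and> - 1 \<le> Re z \<and> Re z \<le> 1" for z :: complex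
  proof -
    show "z \<in> closed_segment 0 1 \<longleftrightarrow> Im z = 0 \<and> 0 \<le> Re z \<and> Re z \<le> 1"
      by (auto simp: closed_segment_def complex_eq_iff)
    show "z \<in> closed_segment (- 1) 0 \<longleftrightarrow> Im z = 0 \<and> - 1 \<le> Re z \<and> Re z \<le> 0"
      by (auto simp: closed_segment_def complex_eq_iff intro!: exI[of _ "1 + Re z"])
    show *: "z \<in> closed_segment (- 1) 1 \<longleftrightarrow> Im z = 0 \<and> - 1 \<le> Re z \<and> Re z \<le> 1"
      by (auto simp: closed_segment_def complex_eq_iff field_simps intro!: exI[of _ "(1 + Re z)/2"])
    show "z \<in> open_segment (- 1) 1 \<longleftrightarrow> Im z = 0 \<and> - 1 < Re z \<and> Re z < 1"
      unfolding open_segment_def using * by (auto simp: complex_eq_iff)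
  qed
  \<comment> \<open>The detour turns at the real point \<open>s\<close>;
    \<open>Re z * s \<le> 0\<close> places \<open>L\<close> on the other side of the imaginary axis.
    The small ball keeps the detour in \<open>D\<close>, hence off \<open>P'\<close>.\<close>
  have route: "connected_component (- (P' \<union> L)) u v"
    if "P' \<inter> D = {}" "\<bar>s\<bar> = \<delta>" "\<And>z. z \<in> L \<Longrightarrow> Im z = 0 \<and> Re z * s \<le> 0" for P' L s
  proof -
    define w where "w = Complex s 0"
    let ?R = "closed_segment u w \<union> closed_segment w v"
    have "?R \<subseteq> ball 0 (2 * \<delta>)"
      using \<delta> that(2) by (intro Un_least closed_segment_subset convex_ball)
        (auto simp: u_def v_def w_def cmod_def)
    moreover have "z \<notin> L" if "z \<in> ?R" for z
    proof
      assume "z \<in> L"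
      then have "Im z = 0" "Re z * s \<le> 0"
        using \<open>\<And>z. z \<in> L \<Longrightarrow> Im z = 0 \<and> Re z * s \<le> 0\<close> by auto
      moreover have "s * s > 0" using \<delta> \<open>\<bar>s\<bar> = \<delta>\<close> by (auto simp: zero_less_mult_iff)
      ultimately show False
        using that \<delta> by (auto simp: closed_segment_def u_def v_def w_def)
    qed
    ultimately have "?R \<subseteq> - (P' \<union> L)"
      using ball \<open>P' \<inter> D = {}\<close> by blast
    moreover have "connected ?R"
      by (intro connected_Un) auto
    ultimately show ?thesis
      unfolding connected_component_def by (intro exI[of _ ?R]) auto
  qed
  have "connected_component (- (P \<union> closed_segment (- 1) 0)) u v"
    by (rule route[where s = \<delta>]) (use assms I in \<open>auto simp: mult_nonpos_nonneg\<close>)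
  moreover have "connected_component (- (Q \<union> closed_segment 0 1)) u v"
    by (rule route[where s = "- \<delta>"]) (use assms I in \<open>auto simp: mult_nonneg_nonneg\<close>)
  moreover have "(P \<union> closed_segment (- 1) 0) \<inter> (Q \<union> closed_segment 0 1) = {0}"
  proof -
    have "P \<inter> closed_segment 0 1 = {}"
    proof (rule equals0I)
      fix z assume z: "z \<in> P \<inter> closed_segment 0 1"
      then have "z \<in> open_segment (- 1) 1 \<or> z = 1" using I by (auto simp: complex_eq_iff)
      then show False using z assms by auto
    qed
    moreover have "Q \<inter> closed_segment (- 1) 0 = {}"
    proof (rule equals0I)
      fix z assume z: "z \<in> Q \<inter> closed_segment (- 1) 0"
      then have "z \<in> open_segment (- 1) 1 \<or> z = - 1" using I by (auto simp: complex_eq_iff)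
      then show False using z assms by auto
    qed
    moreover have "closed_segment (- 1) 0 \<inter> closed_segment 0 1 = {0::complex}"
      using I by (auto simp: complex_eq_iff)
    ultimately show ?thesis using \<open>P \<inter> Q = {}\<close> by blast
  qed
  ultimately have "connected_component (- ((P \<union> closed_segment (- 1) 0) \<union> (Q \<union> closed_segment 0 1))) u v"
    using assms by - (rule Janiszewski, simp_all add: compact_imp_closed compact_Un closed_Un del: Compl_Un)
  moreover have "(P \<union> closed_segment (- 1) 0) \<union> (Q \<union> closed_segment 0 1) = P \<union> Q \<union> closed_segment (- 1) 1"
    using I by auto
  ultimately show ?thesis by (simp add: u_def v_def)
qed

text \<open>An affine change of coordinates carries \<open>p\<close> and \<open>q\<close> to -1 and
  1 and reduces this to the two standard cases. \<open>P\<close> and \<open>Q\<close> are quantified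
  inside the conclusion so that one pair \<open>u\<close>, \<open>v\<close> serves for the
  separation in \<open>D\<close> and for all \<open>P\<close> and \<open>Q\<close>.\<close>

lemma crosscut:
  fixes D :: "complex set"
  assumes "open D" "simply_connected D" "p \<notin> D" "q \<notin> D" "p \<noteq> q"
    and seg: "open_segment p q \<subseteq> D" and "\<epsilon> > 0"
  obtains u v where "dist (midpoint p q) u < \<epsilon>" "dist (midpoint p q) v < \<epsilon>"
    "u \<in> D - closed_segment p q" "v \<in> D - closed_segment p q"
    "\<not> connected_component (D - closed_segment p q) u v"
    "\<And>P Q. \<lbrakk>compact P; compact Q; P \<inter> Q = {}; P \<inter> D = {}; Q \<inter> D = {}; p \<in> P; q \<in> Q\<rbrakk>
      \<Longrightarrow> connected_component (- (P \<union> Q \<union> closed_segment p q)) u v"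
proof -
  define c where "c = midpoint p q"
  define e where "e = (q - p) / 2"
  define \<phi> where "\<phi> = (\<lambda>z. c + e * z)"
  define \<psi> where "\<psi> = (\<lambda>w. (w - c) / e)"
  have "e \<noteq> 0" using \<open>p \<noteq> q\<close> by (simp add: e_def)
  then have [simp]: "\<phi> (\<psi> w) = w" "\<psi> (\<phi> z) = z" for w z
    by (auto simp: \<phi>_def \<psi>_def)
  have inj: "inj \<phi>" "inj \<psi>"
    by (metis injI \<open>\<And>z. \<psi> (\<phi> z) = z\<close>, metis injI \<open>\<And>w. \<phi> (\<psi> w) = w\<close>)
  have "bij \<phi>"
    by (rule o_bij[where g = \<psi>]) (auto simp: fun_eq_iff)
  have cont: "continuous_on S \<phi>" "continuous_on S \<psi>" for S
    unfolding \<phi>_def \<psi>_def by (intro continuous_intros; use \<open>e \<noteq> 0\<close> in simp)+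
  have endpts: "\<phi> (- 1) = p" "\<phi> 1 = q" "\<psi> p = - 1" "\<psi> q = 1" "\<phi> 0 = c"
    using \<open>e \<noteq> 0\<close>
    by (auto simp: \<phi>_def \<psi>_def c_def e_def midpoint_def scaleR_conv_of_real field_simps)
  have \<phi>: "\<phi> ((1 - t) *\<^sub>R x + t *\<^sub>R y) = (1 - t) *\<^sub>R \<phi> x + t *\<^sub>R \<phi> y" for t x y
    by (simp add: \<phi>_def scaleR_conv_of_real algebra_simps)
  have cs: "closed_segment p q = \<phi> ` closed_segment (- 1) 1"
    unfolding closed_segment_image_interval image_image \<phi> endpts ..
  then have cs': "closed_segment (- 1) 1 = \<psi> ` closed_segment p q"
    by (simp add: image_image)
  have os': "open_segment (- 1) 1 = \<psi> ` open_segment p q"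
    unfolding open_segment_def cs' using endpts inj by (simp add: image_set_diff)
  define D' where "D' = \<psi> ` D"
  have D'_eq: "D' = \<phi> -` D"
    by (auto simp: D'_def image_iff) (metis \<open>\<And>z. \<psi> (\<phi> z) = z\<close>)
  have "open D'"
    unfolding D'_eq using cont(1)[of UNIV] \<open>open D\<close> by (simp add: open_vimage)
  have "D homeomorphic D'"
    unfolding D'_def by (rule homeomorphicI[where f = \<psi> and g = \<phi>]) (auto simp: image_image cont)
  then have "simply_connected D'"
    using \<open>simply_connected D\<close> homeomorphic_simply_connected by blast
  have "0 \<in> D'"
  proof -
    have "c \<in> D" using seg \<open>p \<noteq> q\<close> by (auto simp: c_def)
    then show ?thesis by (simp add: D'_eq endpts)
  qed
  then obtain \<rho> where \<rho>: "\<rho> > 0" "ball 0 \<rho> \<subseteq> D'"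
    using \<open>open D'\<close> openE by blast
  \<comment> \<open>The three bounds keep \<delta> below 1, the ball of radius
    \<open>2 * \<delta>\<close> inside \<open>D'\<close>, and, as \<open>\<phi>\<close> scales by
    \<open>cmod e\<close>, the images of \<open>u\<close> and \<open>v\<close> within \<epsilon> of
    the midpoint.\<close>
  define \<delta> where "\<delta> = min (1/2) (min (\<rho>/2) (\<epsilon> / (2 * cmod e)))"
  have \<delta>: "0 < \<delta>" "\<delta> < 1" "2 * \<delta> \<le> \<rho>" "\<delta> * cmod e < \<epsilon>"
  proof -
    have "\<delta> \<le> \<epsilon> / (2 * cmod e)" by (simp add: \<delta>_def)
    then show "\<delta> * cmod e < \<epsilon>" using \<open>e \<noteq> 0\<close> \<open>\<epsilon> > 0\<close> by (simp add: field_simps)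
  qed (use \<rho> \<open>e \<noteq> 0\<close> \<open>\<epsilon> > 0\<close> in \<open>auto simp: \<delta>_def\<close>)
  have ball: "ball 0 (2 * \<delta>) \<subseteq> D'" using \<rho> \<delta> by (meson ball_subset_ball_iff subset_ball subset_trans)
  define u where "u = Complex 0 \<delta>"
  define v where "v = Complex 0 (- \<delta>)"
  have vert: "closed_segment u v \<subseteq> D'"
  proof -
    have "closed_segment u v \<subseteq> ball 0 (2 * \<delta>)"
      using \<delta> by (intro closed_segment_subset convex_ball) (auto simp: u_def v_def cmod_def)
    then show ?thesis using ball by blast
  qed
  have img: "connected_component (f ` S) (f a) (f b)"
    if "connected_component S a b" "\<And>S. continuous_on S f" for f :: "complex \<Rightarrow> complex" and S a b
  proof -
    obtain T where "connected T" "T \<subseteq> S" "a \<in> T" "b \<in> T"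
      using \<open>connected_component S a b\<close> by (auto simp: connected_component_def)
    then show ?thesis unfolding connected_component_def
      by (intro exI[of _ "f ` T"]) (auto intro: connected_continuous_image that(2))
  qed
  have off: "z \<notin> closed_segment (- 1) 1" if "z = u \<or> z = v" for z
    using that \<delta> by (auto simp: closed_segment_def u_def v_def complex_eq_iff)
  show thesis
  proof (rule that[of "\<phi> u" "\<phi> v"])
    have "dist (midpoint p q) (\<phi> z) < \<epsilon>" if "cmod z = \<delta>" for z
      using \<delta> that by (simp add: \<phi>_def dist_norm norm_mult mult.commute flip: c_def)
    then show "dist (midpoint p q) (\<phi> u) < \<epsilon>" "dist (midpoint p q) (\<phi> v) < \<epsilon>"
      using \<delta> by (auto simp: u_def v_def cmod_def)
    have "\<phi> z \<in> D - closed_segment p q" if "z = u \<or> z = v" for z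
      using off[OF that] vert that inj unfolding cs D'_eq by (auto dest: injD)
    then show "\<phi> u \<in> D - closed_segment p q" "\<phi> v \<in> D - closed_segment p q" by auto
    show "\<not> connected_component (D - closed_segment p q) (\<phi> u) (\<phi> v)"
    proof
      assume "connected_component (D - closed_segment p q) (\<phi> u) (\<phi> v)"
      from img[OF this, of \<psi>] have "connected_component (D' - closed_segment (- 1) 1) u v"
        unfolding cs' D'_def using inj by (simp add: image_set_diff cont)
      moreover have "\<not> connected_component (D' - closed_segment (- 1) 1) u v"
        unfolding u_def v_def
      proof (rule crosscut_separates_standard)
        show "- 1 \<notin> D'" "1 \<notin> D'" using assms by (auto simp: D'_eq endpts)
      qed (use \<open>open D'\<close> \<open>simply_connected D'\<close> \<delta> vert in \<open>auto simp: u_def v_def\<close>)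
      ultimately show False by blast
    qed
    show "connected_component (- (P \<union> Q \<union> closed_segment p q)) (\<phi> u) (\<phi> v)"
      if "compact P" "compact Q" "P \<inter> Q = {}" "P \<inter> D = {}" "Q \<inter> D = {}" "p \<in> P" "q \<in> Q" for P Q
    proof -
      have "connected_component (- (\<psi> ` P \<union> \<psi> ` Q \<union> closed_segment (- 1) 1)) u v"
        unfolding u_def v_def
      proof (rule crosscut_sides_standard[where D = D'])
        show "compact (\<psi> ` P)" "compact (\<psi> ` Q)" using that cont compact_continuous_image by blast+
        show "\<psi> ` P \<inter> \<psi> ` Q = {}" "\<psi> ` P \<inter> D' = {}" "\<psi> ` Q \<inter> D' = {}"
          using that inj by (auto simp: D'_def dest: injD)
        show "- 1 \<in> \<psi> ` P" "1 \<in> \<psi> ` Q" using that endpts by (metis image_eqI)+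
        show "open_segment (- 1) 1 \<subseteq> D'" using seg by (auto simp: os' D'_def)
      qed (use \<delta> ball in auto)
      moreover have "\<phi> ` (- (\<psi> ` P \<union> \<psi> ` Q \<union> closed_segment (- 1) 1)) = - (P \<union> Q \<union> closed_segment p q)"
        using \<open>bij \<phi>\<close> by (simp only: bij_image_Compl_eq image_Un image_image cs) simp
      ultimately show ?thesis
        using img cont(1) by metis
    qed
  qed
qed

section \<open>Domains with the cigar condition\<close>

text \<open>The John condition with connected sets in place of curves and distances to the end
  points in place of arc lengths. Ranging over single boundary points avoids the distance to a
  possibly empty set.\<close>

definition cigar_connected :: "real \<Rightarrow> complex set \<Rightarrow> bool" where
  "cigar_connected A D \<longleftrightarrow> (\<forall>a\<in>D. \<forall>b\<in>D. a \<noteq> b \<longrightarrow>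
     (\<exists>T. connected T \<and> T \<subseteq> D \<and> a \<in> T \<and> b \<in> T \<and>
        (\<forall>w\<in>T. \<forall>x\<in>frontier D. min (dist w a) (dist w b) \<le> A * dist w x)))"

text \<open>A closest pair \<open>p\<close>, \<open>q\<close> of points of \<open>P - D\<close> and
  \<open>Q - D\<close> on the segment from \<open>x\<close> to \<open>y\<close> spans a crosscut
  inside the disc of radius \<open>s\<close>. Both of its sides reach norm \<open>R\<close>, so a
  cigar between far points of the two sides meets the crosscut at some \<open>w\<close>. There the
  end points are at distance at least \<open>R - s\<close>, but \<open>p\<close> is at distance at
  most \<open>2 * s\<close>.\<close>

lemma cigar_connected_bounded_turning:
  fixes D :: "complex set"
  assumes "open D" "simply_connected D" and cigar: "cigar_connected A D" and "A \<ge> 0"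
    and "compact P" "compact Q" "P \<inter> Q = {}" and PQ: "cball 0 R - D \<subseteq> P \<union> Q"
    and x: "x \<in> P - D" "norm x \<le> s" and y: "y \<in> Q - D" "norm y \<le> s"
  shows "R - s \<le> 2 * A * s"
proof (rule ccontr)
  assume "\<not> ?thesis"
  have "s \<ge> 0" using x norm_ge_zero order_trans by blast
  with \<open>\<not> ?thesis\<close> have "s < R" "2 * A * s < R - s"
    using \<open>A \<ge> 0\<close> by (auto simp: not_le) (smt (verit) mult_nonneg_nonneg)
  let ?L = "closed_segment x y"
  have L: "norm z \<le> s" if "z \<in> ?L" for z
    using that x y closed_segment_subset[of x "cball 0 s" y] by auto
  define P1 where "P1 = P - D"
  define Q1 where "Q1 = Q - D"
  have [intro]: "compact P1" "compact Q1"
    using assms by (auto simp: P1_def Q1_def compact_diff)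
  have "compact ((P1 \<inter> ?L) \<times> (Q1 \<inter> ?L))"
    by (intro compact_Times compact_Int) auto
  moreover have "(x, y) \<in> (P1 \<inter> ?L) \<times> (Q1 \<inter> ?L)"
    using x y by (auto simp: P1_def Q1_def)
  moreover have "continuous_on ((P1 \<inter> ?L) \<times> (Q1 \<inter> ?L)) (\<lambda>z. dist (fst z) (snd z))"
    by (intro continuous_intros)
  ultimately obtain pq where pq: "pq \<in> (P1 \<inter> ?L) \<times> (Q1 \<inter> ?L)"
    "\<forall>z\<in>(P1 \<inter> ?L) \<times> (Q1 \<inter> ?L). dist (fst pq) (snd pq) \<le> dist (fst z) (snd z)"
    using continuous_attains_inf by (metis (no_types, lifting) empty_iff)
  obtain p q where [simp]: "pq = (p, q)" by (cases pq)
  have p: "p \<in> P1" "p \<in> ?L" and q: "q \<in> Q1" "q \<in> ?L"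
    and min: "\<And>p' q'. \<lbrakk>p' \<in> P1; p' \<in> ?L; q' \<in> Q1; q' \<in> ?L\<rbrakk> \<Longrightarrow> dist p q \<le> dist p' q'"
    using pq by force+
  have "p \<noteq> q" using p q \<open>P \<inter> Q = {}\<close> by (auto simp: P1_def Q1_def)
  have seg_L: "closed_segment p q \<subseteq> ?L"
    using p q by (simp add: subset_closed_segment)
  \<comment> \<open>A point of the open segment outside \<open>D\<close> would lie in
    \<open>P1\<close> or \<open>Q1\<close> and give a closer pair.\<close>
  have seg: "open_segment p q \<subseteq> D"
  proof
    fix z assume z: "z \<in> open_segment p q"
    then have "z \<in> ?L" using seg_L by (auto simp: open_segment_def)
    have "dist z q < dist p q" "dist p z < dist p q"
      using dist_in_open_segment[OF z] by (auto simp: dist_commute)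
    show "z \<in> D"
    proof (rule ccontr)
      assume "z \<notin> D"
      then have "z \<in> P1 \<or> z \<in> Q1"
        using subsetD[OF PQ, of z] L[OF \<open>z \<in> ?L\<close>] \<open>s < R\<close> by (auto simp: P1_def Q1_def)
      then show False
        using min[of z q] min[of p z] p q \<open>z \<in> ?L\<close> \<open>dist z q < dist p q\<close> \<open>dist p z < dist p q\<close> by force
    qed
  qed
  let ?\<sigma> = "closed_segment p q"
  have "p \<notin> D" "q \<notin> D" using p q by (auto simp: P1_def Q1_def)
  obtain u v where uv: "dist (midpoint p q) u < R - s" "dist (midpoint p q) v < R - s"
    "u \<in> D - ?\<sigma>" "v \<in> D - ?\<sigma>" "\<not> connected_component (D - ?\<sigma>) u v"
    "connected_component (- (P1 \<union> Q1 \<union> ?\<sigma>)) u v"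
  proof (rule crosscut[OF \<open>open D\<close> \<open>simply_connected D\<close> \<open>p \<notin> D\<close> \<open>q \<notin> D\<close> \<open>p \<noteq> q\<close> seg])
    show "0 < R - s" using \<open>s < R\<close> by simp
    fix u v
    assume *: "dist (midpoint p q) u < R - s" "dist (midpoint p q) v < R - s"
      "u \<in> D - ?\<sigma>" "v \<in> D - ?\<sigma>" "\<not> connected_component (D - ?\<sigma>) u v"
      and "\<And>P Q. \<lbrakk>compact P; compact Q; P \<inter> Q = {}; P \<inter> D = {}; Q \<inter> D = {}; p \<in> P; q \<in> Q\<rbrakk>
      \<Longrightarrow> connected_component (- (P \<union> Q \<union> closed_segment p q)) u v"
    moreover have "P1 \<inter> Q1 = {}" "P1 \<inter> D = {}" "Q1 \<inter> D = {}"
      using \<open>P \<inter> Q = {}\<close> by (auto simp: P1_def Q1_def)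
    ultimately have "connected_component (- (P1 \<union> Q1 \<union> ?\<sigma>)) u v"
      using p q \<open>compact P1\<close> \<open>compact Q1\<close> by blast
    with * show thesis by (rule that)
  qed
  \<comment> \<open>If the side of \<open>a\<close> stayed in the disc, a connected set from
    \<open>a\<close> to \<open>b\<close> off \<open>P1\<close>, \<open>Q1\<close> and the crosscut
    would meet the frontier of that side. This frontier lies off \<open>D\<close> or on the
    crosscut, and within the disc, so in one of the three avoided sets.\<close>
  have far: "\<exists>z. connected_component (D - ?\<sigma>) a z \<and> norm z \<ge> R"
    if ab: "a \<in> D - ?\<sigma>" "\<not> connected_component (D - ?\<sigma>) a b"
      "connected_component (- (P1 \<union> Q1 \<union> ?\<sigma>)) a b" for a b
  proof (rule ccontr)
    let ?O = "connected_component_set (D - ?\<sigma>) a"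
    assume "\<not> ?thesis"
    then have "?O \<subseteq> cball 0 R" by (auto simp: not_le)
    then have clos: "closure ?O \<subseteq> cball 0 R" by (simp add: closure_minimal)
    obtain T where T: "connected T" "T \<subseteq> - (P1 \<union> Q1 \<union> ?\<sigma>)" "a \<in> T" "b \<in> T"
      using ab(3) by (auto simp: connected_component_def)
    have "a \<in> ?O" using ab by (simp add: connected_component_refl)
    then have "T \<inter> frontier ?O \<noteq> {}"
      using T ab by (intro connected_Int_frontier) auto
    then obtain w where w: "w \<in> T" "w \<in> frontier ?O" by blast
    have "closed (- (D - ?\<sigma>))" using \<open>open D\<close> by (simp only: closed_Compl open_Diff closed_segment)
    moreover have "?O \<in> components (- (- (D - ?\<sigma>)))" using ab(1) by (simp only: double_compl componentsI)
    ultimately have "frontier ?O \<subseteq> - (D - ?\<sigma>)"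
      by (rule frontier_of_components_closed_complement)
    then have "w \<notin> D" using w T by auto
    moreover have "w \<in> cball 0 R" using w clos by (auto simp: frontier_def)
    ultimately have "w \<in> P1 \<union> Q1" using PQ by (auto simp: P1_def Q1_def)
    then show False using w T by auto
  qed
  obtain z1 where z1: "connected_component (D - ?\<sigma>) u z1" "norm z1 \<ge> R"
    using far uv by blast
  obtain z2 where z2: "connected_component (D - ?\<sigma>) v z2" "norm z2 \<ge> R"
    using far[of v u] uv connected_component_sym by blast
  have sep: "\<not> connected_component (D - ?\<sigma>) z1 z2"
    using uv(5) z1 z2 by (meson connected_component_sym connected_component_trans)
  have "z1 \<in> D - ?\<sigma>" "z2 \<in> D - ?\<sigma>"
    using z1 z2 connected_component_in by blast+
  moreover from this have "z1 \<noteq> z2" using sep by (auto simp: connected_component_refl)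
  ultimately obtain T where T: "connected T" "T \<subseteq> D" "z1 \<in> T" "z2 \<in> T"
    "\<forall>w\<in>T. \<forall>x\<in>frontier D. min (dist w z1) (dist w z2) \<le> A * dist w x"
    using cigar unfolding cigar_connected_def by blast
  have "T \<inter> ?\<sigma> \<noteq> {}"
    using T sep unfolding connected_component_def by blast
  then obtain w where w: "w \<in> T" "w \<in> ?\<sigma>" by blast
  have "p \<in> closure (open_segment p q)" using \<open>p \<noteq> q\<close> by simp
  then have "p \<in> closure D" using closure_mono[OF seg] by auto
  then have "p \<in> frontier D" using \<open>p \<notin> D\<close> \<open>open D\<close> by (simp add: frontier_def interior_open)
  then have "min (dist w z1) (dist w z2) \<le> A * dist w p" using T w by blast
  moreover have "norm w \<le> s" "norm p \<le> s" using w seg_L L p by auto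
  moreover have "dist w p \<le> 2 * s"
    using \<open>norm w \<le> s\<close> \<open>norm p \<le> s\<close> norm_triangle_ineq4[of w p] by (simp add: dist_norm)
  then have "A * dist w p \<le> A * (2 * s)" using \<open>A \<ge> 0\<close> by (rule mult_left_mono)
  moreover have "dist w z1 \<ge> R - s" "dist w z2 \<ge> R - s"
    using z1(2) z2(2) \<open>norm w \<le> s\<close> norm_triangle_ineq2[of z1 w] norm_triangle_ineq2[of z2 w]
    by (auto simp: dist_norm norm_minus_commute)
  ultimately show False using \<open>2 * A * s < R - s\<close> by (auto simp: min_def split: if_splits)
qed

section \<open>Auxiliary facts: frontier crossing, area counting, separation of compact sets\<close>

lemma connected_subset_of_Int_frontier_empty:
  assumes "connected T" "T \<inter> S \<noteq> {}" "T \<inter> frontier S = {}"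
  shows "T \<subseteq> S"
  using connected_Int_frontier[OF assms(1,2)] assms(3) by blast

text \<open>The areas of the disjoint discs add up to at most the area of the large disc.\<close>

lemma card_disjoint_balls_le:
  fixes c :: "'i \<Rightarrow> complex"
  assumes "finite I" and disj: "disjoint_family_on (\<lambda>i. ball (c i) \<rho>) I"
    and sub: "\<And>i. i \<in> I \<Longrightarrow> ball (c i) \<rho> \<subseteq> ball 0 R" and "\<rho> > 0"
  shows "real (card I) \<le> (R / \<rho>)\<^sup>2"
proof (cases "I = {}")
  case False
  then obtain i where "i \<in> I" by blast
  then have "c i \<in> ball 0 R" using sub \<open>\<rho> > 0\<close> by force
  then have "R > 0" using le_less_trans[OF norm_ge_zero] by auto
  have "(\<Sum>i\<in>I. measure lebesgue (ball (c i) \<rho>)) = measure lebesgue (\<Union>i\<in>I. ball (c i) \<rho>)"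
    using disj \<open>finite I\<close>
    by (intro measure_finite_Union[symmetric]) (use emeasure_lborel_ball_finite in \<open>auto simp: less_top[symmetric]\<close>)
  also have "\<dots> \<le> measure lebesgue (ball 0 R :: complex set)"
    using sub \<open>finite I\<close> by (intro measure_mono_fmeasurable) auto
  finally have "real (card I) * (pi * \<rho>\<^sup>2) \<le> pi * R\<^sup>2"
    using \<open>\<rho> > 0\<close> \<open>R > 0\<close> by (simp add: content_ball unit_ball_vol_2)
  then have "pi * (real (card I) * \<rho>\<^sup>2) \<le> pi * R\<^sup>2" by (simp add: mult_ac)
  then have "real (card I) * \<rho>\<^sup>2 \<le> R\<^sup>2" by simp
  then show ?thesis using \<open>\<rho> > 0\<close> by (simp add: field_simps)
qed auto

text \<open>By the Sura-Bura theorem, the component of \<open>x\<close> in the compact set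
  \<open>S\<close> has a compact relatively open neighbourhood \<open>K\<close> that avoids
  \<open>y\<close>.\<close>

lemma closed_separation_of_points:
  fixes S :: "'a::euclidean_space set"
  assumes "compact S" "x \<in> S" "y \<in> S" "\<not> connected_component S x y"
  obtains P Q where "compact P" "compact Q" "P \<inter> Q = {}" "P \<union> Q = S" "x \<in> P" "y \<in> Q"
proof -
  let ?C = "connected_component_set S x"
  have "?C \<in> components S" using assms by (simp add: componentsI)
  moreover have "compact ?C" using \<open>compact S\<close> \<open>?C \<in> components S\<close> by (rule compact_components)
  moreover have "locally compact S"
    using \<open>compact S\<close> by (simp add: closed_imp_locally_compact compact_imp_closed)
  moreover have "?C \<subseteq> - {y}" using assms by auto
  ultimately obtain K where K: "openin (top_of_set S) K" "compact K" "?C \<subseteq> K" "K \<subseteq> - {y}"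
    using Sura_Bura_clopen_subset[of S ?C "- {y}"] by auto
  have "closedin (top_of_set S) (S - K)"
    using closedin_diff[OF closedin_topspace K(1)] by simp
  then have "compact (S - K)" using \<open>compact S\<close> by (simp add: closedin_compact)
  moreover have "K \<subseteq> S" using K openin_imp_subset by blast
  moreover have "x \<in> K" using K assms by (auto simp: connected_component_refl subset_iff)
  ultimately show thesis using that[of K "S - K"] K assms by blast
qed

section \<open>Local Hausdorff limits\<close>

text \<open>What is kept of the blow-ups of a bounded simply connected John domain, without base
  points and scales. The assumption \<open>far\<close>, for every \<open>M\<close>, stands for the
  scales tending to 0; the constant \<open>A\<close> is the same for all \<open>n\<close>.\<close>

locale cigar_limit =
  fixes D :: "nat \<Rightarrow> complex set" and A :: real and Y :: "complex set"
  assumes A: "A \<ge> 1"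
    and open_D: "open (D n)" and sc_D: "simply_connected (D n)" and bdd_D: "bounded (D n)"
    and cigar: "cigar_connected A (D n)"
    and far: "eventually (\<lambda>n. \<exists>b\<in>D n. M < norm b) sequentially"
    and closed_Y: "closed Y" and Y_nonempty: "Y \<noteq> {}"
    and lim: "local_Hausdorff_lim (\<lambda>n. frontier (D n)) Y"
begin

section \<open>Consequences of local Hausdorff convergence\<close>

lemma Y_approx:
  assumes "bounded K" "\<epsilon> > 0"
  shows "eventually (\<lambda>n. \<forall>y\<in>Y \<inter> K. \<exists>x\<in>frontier (D n). dist y x < \<epsilon>) sequentially"
proof -
  obtain B where B: "B > 0" "K \<subseteq> ball 0 B"
    using bounded_subset_ballD[OF \<open>bounded K\<close>] by metis
  have "\<forall>R>0. \<forall>\<epsilon>>0. \<exists>N. \<forall>n\<ge>N.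
      Y \<inter> ball 0 (R - \<epsilon>) \<subseteq> open_nbhd \<epsilon> (frontier (D n) \<inter> ball 0 R)"
    using lim unfolding local_Hausdorff_lim_def by meson
  \<comment> \<open>With outer radius \<open>B + \<epsilon>\<close> the inner ball in the definition
    of convergence is exactly \<open>ball 0 B\<close>.\<close>
  moreover have "B + \<epsilon> > 0" using B \<open>\<epsilon> > 0\<close> by simp
  ultimately obtain N where
    "\<forall>n\<ge>N. Y \<inter> ball 0 (B + \<epsilon> - \<epsilon>) \<subseteq> open_nbhd \<epsilon> (frontier (D n) \<inter> ball 0 (B + \<epsilon>))"
    using \<open>\<epsilon> > 0\<close> by meson
  then have N: "\<forall>n\<ge>N. Y \<inter> ball 0 B \<subseteq> open_nbhd \<epsilon> (frontier (D n) \<inter> ball 0 (B + \<epsilon>))"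
    by simp
  show ?thesis
    unfolding eventually_sequentially
  proof (intro exI[of _ N] allI impI ballI)
    fix n y assume "N \<le> n" "y \<in> Y \<inter> K"
    then have "y \<in> open_nbhd \<epsilon> (frontier (D n) \<inter> ball 0 (B + \<epsilon>))"
      using N B by blast
    then show "\<exists>x\<in>frontier (D n). dist y x < \<epsilon>"
      by (auto simp: open_nbhd_def dist_commute)
  qed
qed

lemma Y_approx_point:
  assumes "y \<in> Y" "\<epsilon> > 0"
  shows "eventually (\<lambda>n. \<exists>x\<in>frontier (D n). dist y x < \<epsilon>) sequentially"
  using Y_approx[of "{y}" \<epsilon>] assms by simp

text \<open>\<open>K\<close> has a positive distance \<delta> from \<open>Y\<close>, while boundary
  points of \<open>D n\<close> in \<open>K\<close> are eventually closer than \<delta> to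
  \<open>Y\<close>. Consequently a connected compact set off \<open>Y\<close> eventually lies on one
  side of the boundary.\<close>

lemma frontier_misses_compact:
  assumes "compact K" "K \<inter> Y = {}"
  shows "eventually (\<lambda>n. frontier (D n) \<inter> K = {}) sequentially"
proof -
  obtain B where B: "B > 0" "K \<subseteq> ball 0 B"
    using bounded_subset_ballD[OF compact_imp_bounded[OF \<open>compact K\<close>]] by metis
  obtain \<delta> where \<delta>: "\<delta> > 0" "\<forall>x\<in>K. \<forall>y\<in>Y. \<delta> \<le> dist x y"
    using separate_compact_closed[OF \<open>compact K\<close> closed_Y] assms by auto
  have "\<forall>R>0. \<forall>\<epsilon>>0. \<exists>N. \<forall>n\<ge>N.
      frontier (D n) \<inter> ball 0 (R - \<epsilon>) \<subseteq> open_nbhd \<epsilon> (Y \<inter> ball 0 R)"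
    using lim unfolding local_Hausdorff_lim_def by meson
  moreover have "B + \<delta> > 0" using B \<delta> by simp
  ultimately obtain N where
    "\<forall>n\<ge>N. frontier (D n) \<inter> ball 0 (B + \<delta> - \<delta>) \<subseteq> open_nbhd \<delta> (Y \<inter> ball 0 (B + \<delta>))"
    using \<delta> by meson
  then have N: "\<forall>n\<ge>N. frontier (D n) \<inter> ball 0 B \<subseteq> open_nbhd \<delta> (Y \<inter> ball 0 (B + \<delta>))"
    by simp
  show ?thesis
    unfolding eventually_sequentially
  proof (intro exI[of _ N] allI impI equals0I)
    fix n x assume "N \<le> n" "x \<in> frontier (D n) \<inter> K"
    then have "x \<in> open_nbhd \<delta> (Y \<inter> ball 0 (B + \<delta>))"
      using N B by blast
    then show False
      using \<delta>(2) \<open>x \<in> _ \<inter> K\<close> by (fastforce simp: open_nbhd_def dist_commute)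
  qed
qed

section \<open>Shape and number of the D-components\<close>

definition comps :: "complex set set" where
  "comps = {U \<in> components (- Y). \<exists>z\<in>U. \<exists>\<^sub>\<infinity>n. z \<in> D n}"

lemma comps_props:
  assumes "U \<in> comps"
  shows "open U" "connected U" "U \<inter> Y = {}" "frontier U \<subseteq> Y" "U \<noteq> {}"
proof -
  have U: "U \<in> components (- Y)" using assms by (simp add: comps_def)
  show "open U" using U closed_Y open_components by blast
  show "connected U" using U in_components_connected by blast
  show "U \<inter> Y = {}" using U in_components_subset by blast
  show "frontier U \<subseteq> Y" using U closed_Y frontier_of_components_closed_complement by blast
  show "U \<noteq> {}" using U in_components_nonempty by blast
qed

lemma connected_subset_component:
  assumes "U \<in> comps" "connected T" "T \<inter> Y = {}" "T \<inter> U \<noteq> {}"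
  shows "T \<subseteq> U"
  using assms connected_subset_of_Int_frontier_empty comps_props(4) by blast

text \<open>A bounded component lies in a compact relatively open subset \<open>K\<close> of
  \<open>Y\<close>. The boundary of a thin neighbourhood \<open>V\<close> of \<open>K\<close> misses
  \<open>Y\<close>, hence eventually \<open>frontier (D n)\<close>. The latter is connected, as
  \<open>D n\<close> is bounded and simply connected, and it meets \<open>V\<close>, so it lies in
  \<open>V\<close>. Then \<open>D n\<close>, having points far out, contains the exterior of a disc,
  contrary to boundedness.\<close>

lemma component_unbounded:
  assumes C: "C \<in> components Y"
  shows "\<not> bounded C"
proof
  assume "bounded C"
  have "closed C" using C closed_Y closed_components by blast
  then have "compact C" using \<open>bounded C\<close> by (simp add: compact_eq_bounded_closed)
  then obtain K where K: "openin (top_of_set Y) K" "compact K" "C \<subseteq> K"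
    using Sura_Bura_clopen_subset[of Y C UNIV, OF closed_imp_locally_compact[OF closed_Y] C]
    by (metis open_UNIV subset_UNIV)
  have "closedin (top_of_set Y) (Y - K)"
    using closedin_diff[OF closedin_topspace K(1)] by simp
  then have "closed (Y - K)" using closed_Y closedin_closed_trans by blast
  then obtain \<delta> where \<delta>: "\<delta> > 0" "\<forall>x\<in>K. \<forall>y\<in>Y - K. \<delta> \<le> dist x y"
    using separate_compact_closed[OF \<open>compact K\<close>, of "Y - K"] by auto
  have "C \<noteq> {}" using C in_components_nonempty by blast
  then have "K \<noteq> {}" using K by auto
  define V where "V = {z. infdist z K < \<delta> / 2}"
  have "V = (\<lambda>z. infdist z K) -` {..<\<delta> / 2}" by (auto simp: V_def)
  then have "open V"
    by (auto intro!: open_vimage continuous_on_infdist continuous_on_id)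
  have fV: "infdist z K = \<delta> / 2" if "z \<in> frontier V" for z
  proof -
    have "closure V \<subseteq> {z. infdist z K \<le> \<delta> / 2}"
      by (rule closure_minimal)
        (auto simp: V_def intro!: closed_Collect_le continuous_intros)
    moreover have "z \<notin> V" using that \<open>open V\<close> by (simp add: frontier_def interior_open)
    ultimately show ?thesis using that by (force simp: frontier_def V_def)
  qed
  have "bounded V"
  proof -
    obtain B where "\<forall>x\<in>K. norm x \<le> B" using \<open>compact K\<close> compact_imp_bounded bounded_iff by metis
    have "norm z \<le> B + \<delta> / 2" if "z \<in> V" for z
    proof -
      obtain x where "x \<in> K" "infdist z K = dist z x"
        using infdist_attains_inf[OF compact_imp_closed[OF \<open>compact K\<close>] \<open>K \<noteq> {}\<close>] by metis
      then show ?thesis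
        using that \<open>\<forall>x\<in>K. norm x \<le> B\<close> norm_triangle_sub[of z x] by (force simp: V_def dist_norm)
    qed
    then show ?thesis by (auto simp: bounded_iff)
  qed
  \<comment> \<open>Points of \<open>K\<close> are at distance 0 from \<open>K\<close> and points of
    \<open>Y - K\<close> at distance at least \<delta>, so the level \<open>\<delta> / 2\<close>
    contains neither.\<close>
  have "frontier V \<inter> Y = {}"
  proof (rule equals0I)
    fix z assume z: "z \<in> frontier V \<inter> Y"
    then have "infdist z K = \<delta> / 2" using fV by auto
    moreover obtain x where "x \<in> K" "infdist z K = dist z x"
      using infdist_attains_inf[OF compact_imp_closed[OF \<open>compact K\<close>] \<open>K \<noteq> {}\<close>] by metis
    moreover have "z \<notin> K" using \<open>infdist z K = \<delta> / 2\<close> \<delta> by auto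
    ultimately show False using \<delta>(2) z \<open>\<delta> > 0\<close> by (force simp: dist_commute)
  qed
  then have e1: "eventually (\<lambda>n. frontier (D n) \<inter> frontier V = {}) sequentially"
    using \<open>bounded V\<close> by (intro frontier_misses_compact) (auto simp: compact_frontier_bounded)
  obtain c where "c \<in> C" using \<open>C \<noteq> {}\<close> by blast
  then have "c \<in> Y" "c \<in> K" using C K in_components_subset by blast+
  then have e2: "eventually (\<lambda>n. \<exists>x\<in>frontier (D n). dist c x < \<delta> / 2) sequentially"
    using Y_approx_point half_gt_zero \<delta>(1) by blast
  obtain B where B: "V \<subseteq> cball 0 B"
    using \<open>bounded V\<close> by (auto simp: bounded_iff subset_iff)
  have "eventually (\<lambda>n. False) sequentially"
    using e1 e2 far[of B]
  proof eventually_elim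
    case (elim n)
    then obtain x b where x: "x \<in> frontier (D n)" "dist c x < \<delta> / 2" and b: "b \<in> D n" "B < norm b"
      by blast
    have "x \<in> V" unfolding V_def using x infdist_le[OF \<open>c \<in> K\<close>, of x] by (auto simp: dist_commute)
    have "connected (frontier (D n))"
      using simply_connected_eq_frontier_properties[OF open_D] sc_D bdd_D by metis
    then have "frontier (D n) \<subseteq> V"
      using \<open>x \<in> V\<close> x elim connected_subset_of_Int_frontier_empty by blast
    then have f: "frontier (D n) \<subseteq> cball 0 B" using B by blast
    have "connected (- cball 0 B :: complex set)"
      by (simp add: connected_complement_bounded_convex)
    moreover have "b \<in> - cball 0 B \<inter> D n" using b by simp
    ultimately have "- cball 0 B \<subseteq> D n"
      using f by (intro connected_subset_of_Int_frontier_empty) blast+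
    then have "bounded (- cball 0 B :: complex set)" using bdd_D bounded_subset by blast
    then show False using cobounded_imp_unbounded[of "- cball 0 B :: complex set"] by simp
  qed
  then show False by simp
qed

text \<open>Carries distance from the boundary of \<open>D n\<close> over to \<open>Y\<close>: half
  of the distance is given up to absorb the error of approximation.\<close>

lemma ball_in_complement:
  assumes w: "\<And>x. x \<in> frontier (D n) \<Longrightarrow> 2 * \<rho> \<le> dist w x"
    and approx: "\<forall>y\<in>Y \<inter> K. \<exists>x\<in>frontier (D n). dist y x < \<rho>"
    and "ball w \<rho> \<subseteq> K"
  shows "ball w \<rho> \<inter> Y = {}"
proof (rule equals0I)
  fix y assume y: "y \<in> ball w \<rho> \<inter> Y"
  then obtain x where x: "x \<in> frontier (D n)" "dist y x < \<rho>" using approx assms(3) by blast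
  then show False using w[OF x(1)] y dist_triangle[of w x y] by auto
qed

text \<open>A cigar in \<open>D n\<close> from a point \<open>z\<close> of \<open>U\<close> to a far
  point leaves \<open>U \<inter> ball 0 R\<close> at some \<open>w\<close>. It cannot do so at a
  point of \<open>Y\<close>, which would be too close to the boundary of \<open>D n\<close>; so
  \<open>w\<close> lies in \<open>U\<close> on the circle of radius \<open>R\<close>, far from both
  ends and hence from the boundary. Only \<open>R0\<close> depends on \<open>U\<close>, not the
  ratio of radii.\<close>

lemma comps_fat:
  assumes U: "U \<in> comps"
  obtains R0 where "R0 > 0" "\<And>R. R \<ge> R0 \<Longrightarrow> \<exists>w. norm w = R \<and> ball w (R / (4 * A)) \<subseteq> U"
proof -
  obtain z where z: "z \<in> U" "\<exists>\<^sub>\<infinity>n. z \<in> D n" using U by (auto simp: comps_def)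
  note U' = comps_props[OF U]
  have "A > 0" using A by simp
  have "z \<notin> Y" using z U' by blast
  then have "infdist z Y > 0"
    using closed_Y Y_nonempty by (metis infdist_nonneg in_closed_iff_infdist_zero less_eq_real_def)
  \<comment> \<open>This bound on \<open>R\<close> puts \<open>z\<close> inside the disc and at
    distance at least \<open>R / 2\<close> from its circle.\<close>
  have "\<exists>w. norm w = R \<and> ball w (R / (4 * A)) \<subseteq> U" if R: "R \<ge> 2 * norm z + 1" for R
  proof -
    have "R > 0" using R norm_ge_zero[of z] by linarith
    \<comment> \<open>A point of \<open>Y\<close> in the closed disc of radius \<open>R\<close> has
      distance at least \<open>m\<close> from both ends of the cigar. Taking
      \<open>A * \<epsilon> < m\<close> excludes such an exit point, and
      \<open>\<epsilon> \<le> R / (4 * A)\<close> is the precision needed for the ball at the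
      end.\<close>
    define m where "m = min (infdist z Y) R"
    define \<epsilon> where "\<epsilon> = min (m / (2 * A)) (R / (4 * A))"
    have "m > 0" using \<open>R > 0\<close> \<open>infdist z Y > 0\<close> by (simp add: m_def)
    then have "\<epsilon> > 0" using \<open>A > 0\<close> \<open>R > 0\<close> by (simp add: \<epsilon>_def)
    have "A * \<epsilon> < m"
    proof -
      have "A * \<epsilon> \<le> A * (m / (2 * A))" using \<open>A > 0\<close> by (intro mult_left_mono) (auto simp: \<epsilon>_def)
      also have "\<dots> < m" using \<open>A > 0\<close> \<open>m > 0\<close> by simp
      finally show ?thesis .
    qed
    have "\<exists>\<^sub>\<infinity>n. z \<in> D n \<and> ((\<exists>b\<in>D n. 2 * R < norm b) \<and>
      (\<forall>y\<in>Y \<inter> cball 0 (2 * R). \<exists>x\<in>frontier (D n). dist y x < \<epsilon>))"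
      using z(2) far[of "2 * R"] Y_approx[OF bounded_cball \<open>\<epsilon> > 0\<close>, of 0 "2 * R"]
      unfolding cofinite_eq_sequentially
      by (intro frequently_eventually_frequently eventually_conj)
    then obtain n b where n: "z \<in> D n" "b \<in> D n" "2 * R < norm b"
      and approx: "\<forall>y\<in>Y \<inter> cball 0 (2 * R). \<exists>x\<in>frontier (D n). dist y x < \<epsilon>"
      by (auto dest: frequently_ex)
    have "norm z < norm b" using n R norm_ge_zero[of z] by linarith
    then have "z \<noteq> b" by auto
    then obtain T where T: "connected T" "T \<subseteq> D n" "z \<in> T" "b \<in> T"
      and cig: "\<And>w x. \<lbrakk>w \<in> T; x \<in> frontier (D n)\<rbrakk> \<Longrightarrow> min (dist w z) (dist w b) \<le> A * dist w x"
      using cigar[of n] n unfolding cigar_connected_def by metis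
    let ?V = "U \<inter> ball 0 R"
    have "norm z < R" using R norm_ge_zero[of z] by linarith
    have "T \<inter> frontier ?V \<noteq> {}"
      using T \<open>z \<in> U\<close> \<open>norm z < R\<close> n \<open>R > 0\<close> by (intro connected_Int_frontier) auto
    then obtain w where w: "w \<in> T" "w \<in> frontier ?V" by blast
    have "open ?V" using U'(1) by (rule open_Int) simp
    have "closure ?V \<subseteq> cball 0 R" by (rule closure_minimal) auto
    then have wR: "norm w \<le> R" using w by (auto simp: frontier_def)
    have "closure ?V \<subseteq> closure U" by (rule closure_mono) auto
    then have "w \<in> closure U" using w by (auto simp: frontier_def)
    have "dist w b \<ge> R" using n wR norm_triangle_ineq2[of b w] by (simp add: dist_norm norm_minus_commute)
    have "w \<in> U"
    proof (rule ccontr)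
      assume "w \<notin> U"
      then have "w \<in> Y" using \<open>w \<in> closure U\<close> U' by (auto simp: frontier_def interior_open)
      moreover have "w \<in> cball 0 (2 * R)" using wR \<open>R > 0\<close> by simp
      ultimately obtain x where x: "x \<in> frontier (D n)" "dist w x < \<epsilon>" using approx by blast
      have "dist w z \<ge> infdist z Y" using infdist_le[OF \<open>w \<in> Y\<close>, of z] by (simp add: dist_commute)
      then have "m \<le> min (dist w z) (dist w b)" using \<open>dist w b \<ge> R\<close> by (auto simp: m_def)
      also have "\<dots> \<le> A * dist w x" using cig w x by blast
      also have "\<dots> \<le> A * \<epsilon>" using x \<open>A > 0\<close> by simp
      finally show False using \<open>A * \<epsilon> < m\<close> by simp
    qed
    have "w \<notin> ?V" using w(2) unfolding frontier_def interior_open[OF \<open>open ?V\<close>] by blast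
    then have "norm w = R" using wR \<open>w \<in> U\<close> by auto
    let ?\<rho> = "R / (4 * A)"
    have "?\<rho> \<le> R" using A \<open>R > 0\<close> by (simp add: field_simps)
    have far: "2 * ?\<rho> \<le> dist w x" if "x \<in> frontier (D n)" for x
    proof -
      have "dist w z \<ge> R / 2"
        using R \<open>norm w = R\<close> norm_triangle_ineq2[of w z] by (simp add: dist_norm)
      then have "R / 2 \<le> A * dist w x"
        using cig[OF w(1) that] \<open>dist w b \<ge> R\<close> \<open>R > 0\<close> by linarith
      then show ?thesis using \<open>A > 0\<close> by (simp add: field_simps)
    qed
    have "ball w ?\<rho> \<inter> Y = {}"
    proof (rule ball_in_complement[OF far])
      show "\<forall>y\<in>Y \<inter> cball 0 (2 * R). \<exists>x\<in>frontier (D n). dist y x < ?\<rho>"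
        using approx by (force simp: \<epsilon>_def)
      show "ball w ?\<rho> \<subseteq> cball 0 (2 * R)"
      proof
        fix x assume "x \<in> ball w ?\<rho>"
        then show "x \<in> cball 0 (2 * R)"
          using \<open>?\<rho> \<le> R\<close> \<open>norm w = R\<close> norm_triangle_sub[of x w]
          by (auto simp: dist_norm norm_minus_commute)
      qed
    qed
    moreover have "w \<in> ball w ?\<rho>" using \<open>R > 0\<close> \<open>A > 0\<close> by simp
    ultimately have "ball w ?\<rho> \<subseteq> U"
      using \<open>w \<in> U\<close> by (intro connected_subset_component[OF U] connected_ball) blast+
    then show ?thesis using \<open>norm w = R\<close> by blast
  qed
  moreover have "2 * norm z + 1 > 0" using norm_ge_zero[of z] by linarith
  ultimately show thesis using that by blast
qed

lemma comps_unbounded: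
  assumes U: "U \<in> comps"
  shows "\<not> bounded U"
proof
  assume "bounded U"
  then obtain B where B: "\<forall>x\<in>U. norm x \<le> B" using bounded_iff by blast
  obtain R0 where R0: "R0 > 0" "\<And>R. R \<ge> R0 \<Longrightarrow> \<exists>w. norm w = R \<and> ball w (R / (4 * A)) \<subseteq> U"
    using comps_fat[OF U] by blast
  have "max R0 (B + 1) \<ge> R0" by simp
  from R0(2)[OF this] obtain w where w: "norm w = max R0 (B + 1)"
    "ball w (max R0 (B + 1) / (4 * A)) \<subseteq> U" by blast
  moreover have "w \<in> ball w (max R0 (B + 1) / (4 * A))" using R0 A by (simp add: less_max_iff_disj)
  ultimately have "norm w \<le> B" using B by blast
  then show False using w by auto
qed

text \<open>It suffices that all components of the complement are unbounded. Each contains a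
  frontier point of \<open>U\<close>, which lies in \<open>Y\<close>, and with it a whole component
  of \<open>Y\<close>, which is unbounded.\<close>

lemma comps_simply_connected:
  assumes U: "U \<in> comps"
  shows "simply_connected U"
proof -
  note U' = comps_props[OF U]
  have "\<not> bounded C" if C: "C \<in> components (- U)" for C
  proof -
    have "C \<noteq> {}" using C in_components_nonempty by blast
    moreover have "C \<noteq> UNIV" using C in_components_subset U' by blast
    ultimately obtain y where y: "y \<in> frontier C" using frontier_eq_empty by auto
    have "closed C" using C U' by (metis closed_Compl closed_components)
    then have "y \<in> C" using y by (simp add: frontier_def)
    have "y \<in> Y" using y frontier_of_components_subset[OF C] U' by (auto simp: frontier_complement)
    let ?E = "connected_component_set Y y"
    have "?E \<subseteq> Y" "connected ?E" "y \<in> ?E"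
      using \<open>y \<in> Y\<close> by (auto simp: connected_component_subset connected_component_refl)
    then have "?E \<subseteq> C"
      using \<open>y \<in> C\<close> U' by (intro components_maximal[OF C]) auto
    moreover have "\<not> bounded ?E" using \<open>y \<in> Y\<close> by (intro component_unbounded componentsI)
    ultimately show ?thesis using bounded_subset by blast
  qed
  then show ?thesis
    using simply_connected_eq_unbounded_complement_components U' by blast
qed

(* Different members of comps may be witnessed by disjoint sets of indices n, so they are compared
   through the disjoint balls of comps_fat and not inside a single D n. *)
lemma card_comps:
  shows "finite comps \<and> card comps \<le> nat \<lfloor>64 * A\<^sup>2\<rfloor>"
proof (rule finite_if_finite_subsets_card_bdd)
  fix F assume F: "F \<subseteq> comps" "finite F"
  have "\<forall>U\<in>F. \<exists>R0>0. \<forall>R\<ge>R0. \<exists>w. norm w = R \<and> ball w (R / (4 * A)) \<subseteq> U"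
    using comps_fat F by (metis subsetD)
  then obtain r where r: "\<And>U. U \<in> F \<Longrightarrow> r U > 0"
    "\<And>U R. U \<in> F \<Longrightarrow> R \<ge> r U \<Longrightarrow> \<exists>w. norm w = R \<and> ball w (R / (4 * A)) \<subseteq> U"
    by metis
  \<comment> \<open>One radius for all members of \<open>F\<close>; the 1 keeps it positive, also
    for empty \<open>F\<close>.\<close>
  define R where "R = Max (insert 1 (r ` F))"
  have "R \<ge> 1" "\<And>U. U \<in> F \<Longrightarrow> R \<ge> r U" using F by (auto simp: R_def)
  then have "\<forall>U\<in>F. \<exists>w. norm w = R \<and> ball w (R / (4 * A)) \<subseteq> U" using r by blast
  then obtain w where w: "\<And>U. U \<in> F \<Longrightarrow> norm (w U) = R" "\<And>U. U \<in> F \<Longrightarrow> ball (w U) (R / (4 * A)) \<subseteq> U"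
    by metis
  have disj: "disjoint_family_on (\<lambda>U. ball (w U) (R / (4 * A))) F"
    unfolding disjoint_family_on_def
  proof (intro ballI impI)
    fix U V assume UV: "U \<in> F" "V \<in> F" "U \<noteq> V"
    then have "U \<inter> V = {}"
      using F components_nonoverlap[of U "- Y" V] by (auto simp: comps_def)
    then show "ball (w U) (R / (4 * A)) \<inter> ball (w V) (R / (4 * A)) = {}"
      using w UV by blast
  qed
  have "R / (4 * A) \<le> R" using A \<open>R \<ge> 1\<close> by (simp add: field_simps)
  have "ball (w U) (R / (4 * A)) \<subseteq> ball 0 (2 * R)" if "U \<in> F" for U
  proof
    fix x assume "x \<in> ball (w U) (R / (4 * A))"
    then show "x \<in> ball 0 (2 * R)"
      using \<open>R / (4 * A) \<le> R\<close> w(1)[OF that] norm_triangle_sub[of x "w U"]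
      by (auto simp: dist_norm norm_minus_commute)
  qed
  from card_disjoint_balls_le[OF F(2) disj this]
  have "real (card F) \<le> (2 * R / (R / (4 * A)))\<^sup>2" using A \<open>R \<ge> 1\<close> by simp
  also have "2 * R / (R / (4 * A)) = 8 * A" using A \<open>R \<ge> 1\<close> by (simp add: field_simps)
  finally show "card F \<le> nat \<lfloor>64 * A\<^sup>2\<rfloor>"
    by (simp add: power_mult_distrib le_nat_floor)
qed

section \<open>\<open>Y\<close> as the union of the boundaries of the D-components\<close>

text \<open>A cigar from a point of \<open>D n\<close> within \<open>\<rho> / 2\<close> of
  \<open>y\<close> to a far point crosses the circle of radius \<rho> about \<open>y\<close>, at
  distance at least \<open>\<rho> / 2\<close> from both ends.\<close>

lemma fat_point_on_sphere:
  assumes "y \<in> Y" "\<rho> > 0"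
  shows "eventually (\<lambda>n. \<exists>w\<in>D n. dist y w = \<rho> \<and> (\<forall>x\<in>frontier (D n). \<rho> / (2 * A) \<le> dist w x)) sequentially"
proof -
  have "\<rho> / 4 > 0" using \<open>\<rho> > 0\<close> by simp
  show ?thesis
    using Y_approx_point[OF \<open>y \<in> Y\<close> \<open>\<rho> / 4 > 0\<close>] far[of "norm y + 2 * \<rho>"]
  proof eventually_elim
    case (elim n)
    then obtain x b where x: "x \<in> frontier (D n)" "dist y x < \<rho> / 4"
      and b: "b \<in> D n" "norm y + 2 * \<rho> < norm b" by blast
    have "x \<in> closure (D n)" using x by (simp add: frontier_def)
    then obtain a where a: "a \<in> D n" "dist a x < \<rho> / 4"
      using \<open>\<rho> / 4 > 0\<close> closure_approachable by blast
    have ya: "dist y a < \<rho> / 2"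
      using a(2) x(2) dist_triangle[of y a x] by (simp add: dist_commute)
    have yb: "dist y b > 2 * \<rho>"
      using b norm_triangle_ineq2[of b y] by (simp add: dist_norm norm_minus_commute)
    have "a \<noteq> b" using ya yb \<open>\<rho> > 0\<close> by auto
    then obtain T where T: "connected T" "T \<subseteq> D n" "a \<in> T" "b \<in> T"
      and cig: "\<And>w x. \<lbrakk>w \<in> T; x \<in> frontier (D n)\<rbrakk> \<Longrightarrow> min (dist w a) (dist w b) \<le> A * dist w x"
      using cigar[of n] a b unfolding cigar_connected_def by metis
    have "a \<in> T \<inter> ball y \<rho>" "b \<in> T - ball y \<rho>" using T ya yb \<open>\<rho> > 0\<close> by auto
    then have "T \<inter> frontier (ball y \<rho>) \<noteq> {}"
      using T by (intro connected_Int_frontier) blast+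
    then obtain w where "w \<in> T" "w \<in> frontier (ball y \<rho>)" by blast
    then have w: "w \<in> T" "dist y w = \<rho>" using \<open>\<rho> > 0\<close> by (auto simp: frontier_ball)
    have "\<rho> / (2 * A) \<le> dist w x'" if "x' \<in> frontier (D n)" for x'
    proof -
      have "dist w a \<ge> \<rho> / 2" using w ya dist_triangle[of y w a] by (simp add: dist_commute)
      moreover have "dist w b \<ge> \<rho>" using w yb dist_triangle[of y b w] by simp
      ultimately have "\<rho> / 2 \<le> A * dist w x'" using cig[OF w(1) that] \<open>\<rho> > 0\<close> by linarith
      then show ?thesis using A by (simp add: field_simps)
    qed
    then show ?case using w T by blast
  qed
qed

text \<open>The fat points on the circle accumulate at some \<open>l\<close>. Since each is the
  centre of a disc of fixed radius \<delta> in its domain, \<open>l\<close> itself lies in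
  infinitely many \<open>D n\<close>, and one such disc that is disjoint from \<open>Y\<close> shows
  that \<open>l\<close> is off \<open>Y\<close>. The component of \<open>l\<close> is then a
  D-component.\<close>

lemma comps_near:
  assumes "y \<in> Y" "\<rho> > 0"
  shows "\<exists>U\<in>comps. \<exists>z\<in>U. dist y z = \<rho>"
proof -
  define \<delta> where "\<delta> = \<rho> / (4 * A)"
  have "\<delta> > 0" "2 * \<delta> = \<rho> / (2 * A)" "\<delta> \<le> \<rho>"
    using A \<open>\<rho> > 0\<close> by (auto simp: \<delta>_def field_simps)
  have "eventually (\<lambda>n. (\<exists>w\<in>D n. dist y w = \<rho> \<and> (\<forall>x\<in>frontier (D n). 2 * \<delta> \<le> dist w x)) \<and>
      (\<forall>y'\<in>Y \<inter> cball y (2 * \<rho>). \<exists>x\<in>frontier (D n). dist y' x < \<delta>)) sequentially"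
    using fat_point_on_sphere[OF assms] Y_approx[OF bounded_cball \<open>\<delta> > 0\<close>]
    unfolding \<open>2 * \<delta> = _\<close> by (rule eventually_conj)
  then obtain N where N: "\<And>n. n \<ge> N \<Longrightarrow> \<exists>w\<in>D n. dist y w = \<rho> \<and> (\<forall>x\<in>frontier (D n). 2 * \<delta> \<le> dist w x)"
      "\<And>n. n \<ge> N \<Longrightarrow> \<forall>y'\<in>Y \<inter> cball y (2 * \<rho>). \<exists>x\<in>frontier (D n). dist y' x < \<delta>"
    unfolding eventually_sequentially by blast
  \<comment> \<open>Shifting the index by \<open>N\<close> gives a fat point for every
    \<open>n\<close>, as needed to choose a sequence.\<close>
  have "\<forall>n. \<exists>w. w \<in> D (n + N) \<and> dist y w = \<rho> \<and> (\<forall>x\<in>frontier (D (n + N)). 2 * \<delta> \<le> dist w x)"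
    using N(1) le_add2 by blast
  then obtain w where w: "\<And>n. w n \<in> D (n + N)" "\<And>n. dist y (w n) = \<rho>"
    "\<And>n x. x \<in> frontier (D (n + N)) \<Longrightarrow> 2 * \<delta> \<le> dist (w n) x"
    by metis
  have "compact (sphere y \<rho>)" by simp
  moreover have "\<forall>n. w n \<in> sphere y \<rho>" using w by simp
  ultimately obtain l h where l: "l \<in> sphere y \<rho>" "strict_mono h" "(w \<circ> h) \<longlonglongrightarrow> l"
    using compact_def by metis
  then obtain k0 where k0: "\<And>k. k \<ge> k0 \<Longrightarrow> dist (w (h k)) l < \<delta>"
    using \<open>\<delta> > 0\<close> unfolding lim_sequentially comp_def by blast
  have "l \<in> D (h k + N)" if "k \<ge> k0" for k
  proof -
    have "ball (w (h k)) \<delta> \<subseteq> D (h k + N)"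
    proof (rule connected_subset_of_Int_frontier_empty)
      show "ball (w (h k)) \<delta> \<inter> D (h k + N) \<noteq> {}"
        using w(1)[of "h k"] \<open>\<delta> > 0\<close> by (metis IntI centre_in_ball empty_iff)
      show "ball (w (h k)) \<delta> \<inter> frontier (D (h k + N)) = {}"
        using w(3) \<open>\<delta> > 0\<close> by fastforce
    qed simp
    then show ?thesis using k0[OF that] by auto
  qed
  \<comment> \<open>The indices \<open>h k + N\<close> are unbounded because
    \<open>h k \<ge> k\<close> for strictly increasing \<open>h\<close>.\<close>
  then have "\<exists>\<^sub>\<infinity>n. l \<in> D n"
    unfolding INFM_nat_le
    by (metis l(2) le_add1 le_trans nat_le_linear seq_suble)
  have "ball (w (h k0)) \<delta> \<inter> Y = {}"
  proof (rule ball_in_complement[OF w(3) N(2)])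
    show "ball (w (h k0)) \<delta> \<subseteq> cball y (2 * \<rho>)"
    proof
      fix x assume "x \<in> ball (w (h k0)) \<delta>"
      then show "x \<in> cball y (2 * \<rho>)"
        using \<open>\<delta> \<le> \<rho>\<close> w(2)[of "h k0"] dist_triangle[of y x "w (h k0)"] by simp
    qed
  qed auto
  then have "l \<notin> Y" using k0[of k0] by auto
  then have "connected_component_set (- Y) l \<in> components (- Y)" "l \<in> connected_component_set (- Y) l"
    by (auto simp: connected_component_refl intro: componentsI)
  then show ?thesis using l \<open>\<exists>\<^sub>\<infinity>n. l \<in> D n\<close> unfolding comps_def by fastforce
qed

text \<open>Points of \<open>Y\<close> are limits of points in D-components; as there are finitely
  many D-components, the closure of their union is the union of their closures.\<close>

lemma Y_eq_frontiers: "Y = (\<Union>U\<in>comps. frontier U)"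
proof
  show "(\<Union>U\<in>comps. frontier U) \<subseteq> Y" using comps_props(4) by blast
  show "Y \<subseteq> (\<Union>U\<in>comps. frontier U)"
  proof
    fix y assume y: "y \<in> Y"
    have "y \<in> closure (\<Union>comps)"
      unfolding closure_approachable
    proof (intro allI impI)
      fix e :: real assume "e > 0"
      then obtain U z where "U \<in> comps" "z \<in> U" "dist y z = e / 2"
        using comps_near[OF y, of "e / 2"] by auto
      then show "\<exists>z\<in>\<Union>comps. dist z y < e" using \<open>e > 0\<close>
        by (intro bexI[of _ z]) (auto simp: dist_commute)
    qed
    moreover have "closure (\<Union>comps) \<subseteq> (\<Union>U\<in>comps. closure U)"
      using card_comps closure_subset by (intro closure_minimal closed_UN) blast+
    ultimately obtain U where U: "U \<in> comps" "y \<in> closure U" by blast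
    then have "y \<in> frontier U"
      using comps_props[OF U(1)] y by (auto simp: frontier_def interior_open)
    then show "y \<in> (\<Union>U\<in>comps. frontier U)" using U by blast
  qed
qed

section \<open>Connectedness of the boundaries and the number of components of
  \<open>Y\<close>\<close>

text \<open>A path in \<open>U\<close> from \<open>z\<close> to \<open>e\<close> together with a
  disc about \<open>e\<close> is compact, connected and off \<open>Y\<close>, so eventually it does
  not meet the boundary of \<open>D n\<close>; finitely many such discs cover \<open>E\<close>. The
  premise \<open>z \<in> D n\<close> stays inside because it is known for infinitely many
  \<open>n\<close> only.\<close>

lemma compact_subset_eventually:
  assumes U: "U \<in> comps" and "z \<in> U" "compact E" "E \<subseteq> U"
  shows "eventually (\<lambda>n. z \<in> D n \<longrightarrow> E \<subseteq> D n) sequentially"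
proof -
  note U' = comps_props[OF U]
  have "\<exists>\<rho>>0. eventually (\<lambda>n. z \<in> D n \<longrightarrow> ball e \<rho> \<subseteq> D n) sequentially" if e: "e \<in> E" for e
  proof -
    obtain \<rho> where \<rho>: "\<rho> > 0" "cball e \<rho> \<subseteq> U"
      using U'(1) e \<open>E \<subseteq> U\<close> unfolding open_contains_cball by blast
    have "path_connected U" using U'(1,2) by (rule connected_open_path_connected)
    then obtain g where g: "path g" "path_image g \<subseteq> U" "pathstart g = z" "pathfinish g = e"
      using e \<open>z \<in> U\<close> \<open>E \<subseteq> U\<close> unfolding path_connected_def by blast
    let ?K = "path_image g \<union> cball e \<rho>"
    have "e \<in> path_image g" "z \<in> path_image g" using g by auto
    have "connected ?K"
      using g \<rho> \<open>e \<in> path_image g\<close> by (intro connected_Un connected_path_image) auto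
    have "compact ?K" using g by (simp add: compact_path_image compact_Un)
    moreover have "?K \<inter> Y = {}" using g \<rho> U' by blast
    ultimately have "eventually (\<lambda>n. frontier (D n) \<inter> ?K = {}) sequentially"
      by (rule frontier_misses_compact)
    then have "eventually (\<lambda>n. z \<in> D n \<longrightarrow> ball e \<rho> \<subseteq> D n) sequentially"
    proof eventually_elim
      case (elim n)
      show ?case
      proof
        assume "z \<in> D n"
        then have "?K \<subseteq> D n"
          using \<open>connected ?K\<close> \<open>z \<in> path_image g\<close> elim
          by (intro connected_subset_of_Int_frontier_empty) auto
        then show "ball e \<rho> \<subseteq> D n" using ball_subset_cball by blast
      qed
    qed
    then show ?thesis using \<rho> by blast
  qed
  then obtain \<rho> where \<rho>: "\<And>e. e \<in> E \<Longrightarrow> \<rho> e > 0"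
    "\<And>e. e \<in> E \<Longrightarrow> eventually (\<lambda>n. z \<in> D n \<longrightarrow> ball e (\<rho> e) \<subseteq> D n) sequentially"
    by metis
  have "E \<subseteq> (\<Union>e\<in>E. ball e (\<rho> e))" using \<rho> by force
  then obtain F where F: "F \<subseteq> E" "finite F" "E \<subseteq> (\<Union>e\<in>F. ball e (\<rho> e))"
    using compactE_image[OF \<open>compact E\<close>, of E "\<lambda>e. ball e (\<rho> e)"] by auto
  have "eventually (\<lambda>n. \<forall>e\<in>F. z \<in> D n \<longrightarrow> ball e (\<rho> e) \<subseteq> D n) sequentially"
    using F \<rho> by (intro eventually_ball_finite) auto
  then show ?thesis
    by eventually_elim (use F in blast)
qed

text \<open>Otherwise the complement of \<open>U\<close> in a large disc splits into compact parts
  around \<open>x\<close> and \<open>y\<close>. For suitable \<open>n\<close> the complement of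
  \<open>D n\<close> splits accordingly, in contradiction to
  \<open>cigar_connected_bounded_turning\<close>.\<close>

lemma frontier_comps_same_component:
  assumes U: "U \<in> comps" and x: "x \<in> frontier U" and y: "y \<in> frontier U"
  shows "connected_component (- U) x y"
proof (rule ccontr)
  assume neg: "\<not> connected_component (- U) x y"
  obtain z where z: "z \<in> U" "\<exists>\<^sub>\<infinity>n. z \<in> D n" using U by (auto simp: comps_def)
  note U' = comps_props[OF U]
  have "x \<in> Y" "y \<in> Y" using x y U' by auto
  \<comment> \<open>The extra 1 leaves room for boundary points of \<open>D n\<close> near
    \<open>x\<close> and \<open>y\<close>; \<open>R\<close> is chosen to violate the bound
    \<open>R - s \<le> 2 * A * s\<close>.\<close>
  define s where "s = max (norm x) (norm y) + 1"
  define R where "R = s + 2 * A * s + 1"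
  have "s \<ge> 1" "norm x + 1 \<le> s" "norm y + 1 \<le> s" by (auto simp: s_def le_max_iff_disj)
  then have "R \<ge> s" "R - s > 2 * A * s" using A by (auto simp: R_def)
  define K where "K = cball 0 R - U"
  have "compact K" using U' by (simp add: K_def compact_diff)
  moreover have "x \<in> K" "y \<in> K"
    using \<open>R \<ge> s\<close> \<open>norm x + 1 \<le> s\<close> \<open>norm y + 1 \<le> s\<close> \<open>x \<in> Y\<close> \<open>y \<in> Y\<close> U' by (auto simp: K_def)
  moreover have "\<not> connected_component K x y"
    using neg connected_component_of_subset[of K x y "- U"] by (auto simp: K_def)
  ultimately obtain P Q where PQ: "compact P" "compact Q" "P \<inter> Q = {}" "P \<union> Q = K" "x \<in> P" "y \<in> Q"
    using closed_separation_of_points by metis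
  obtain \<delta> where \<delta>: "\<delta> > 0" "\<forall>p\<in>P. \<forall>q\<in>Q. \<delta> \<le> dist p q"
    using separate_compact_closed[of P Q] PQ compact_imp_closed by metis
  define \<eta> where "\<eta> = min (\<delta> / 3) 1"
  have \<eta>: "\<eta> > 0" "2 * \<eta> < \<delta>" "\<eta> \<le> 1" using \<delta> by (auto simp: \<eta>_def)
  define P' where "P' = {w. infdist w P \<le> \<eta>}"
  define Q' where "Q' = {w. infdist w Q \<le> \<eta>}"
  have "P \<noteq> {}" "Q \<noteq> {}" using PQ by auto
  have "compact P'" "compact Q'"
    unfolding P'_def Q'_def using PQ \<open>P \<noteq> {}\<close> \<open>Q \<noteq> {}\<close> \<eta> by (auto intro: compact_infdist_le)
  have "P' \<inter> Q' = {}"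
  proof (rule equals0I)
    fix w assume w: "w \<in> P' \<inter> Q'"
    obtain p where p: "p \<in> P" "infdist w P = dist w p"
      using infdist_attains_inf[OF compact_imp_closed[OF \<open>compact P\<close>] \<open>P \<noteq> {}\<close>] by metis
    obtain q where q: "q \<in> Q" "infdist w Q = dist w q"
      using infdist_attains_inf[OF compact_imp_closed[OF \<open>compact Q\<close>] \<open>Q \<noteq> {}\<close>] by metis
    have "dist p q \<le> dist w p + dist w q" by (rule dist_triangle3)
    then show False using \<delta>(2) p q w \<eta> by (force simp: P'_def Q'_def)
  qed
  \<comment> \<open>The part of the disc not close to \<open>P\<close> or \<open>Q\<close>. It is a
    compact subset of \<open>U\<close>, so it is eventually absorbed by the \<open>D n\<close> that
    contain \<open>z\<close>, and the rest of the disc lies in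
    \<open>P' \<union> Q'\<close>.\<close>
  define E where "E = cball 0 R \<inter> ({w. \<eta> \<le> infdist w P} \<inter> {w. \<eta> \<le> infdist w Q})"
  have "closed ({w. \<eta> \<le> infdist w P} \<inter> {w. \<eta> \<le> infdist w Q})"
    by (intro closed_Int closed_Collect_le continuous_intros)
  then have "compact E" unfolding E_def by (intro compact_Int_closed) auto
  moreover have "E \<subseteq> U"
  proof
    fix w assume w: "w \<in> E"
    show "w \<in> U"
    proof (rule ccontr)
      assume "w \<notin> U"
      then have "w \<in> P \<union> Q" using w PQ(4) by (auto simp: E_def K_def)
      then show False using w \<eta> by (auto simp: E_def)
    qed
  qed
  ultimately have ev: "eventually (\<lambda>n. z \<in> D n \<longrightarrow> E \<subseteq> D n) sequentially"
    using compact_subset_eventually[OF U z(1)] by blast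
  have "\<exists>\<^sub>\<infinity>n. z \<in> D n \<and> ((z \<in> D n \<longrightarrow> E \<subseteq> D n) \<and>
    ((\<exists>x'\<in>frontier (D n). dist x x' < \<eta>) \<and> (\<exists>y'\<in>frontier (D n). dist y y' < \<eta>)))"
    using z(2) ev Y_approx_point[OF \<open>x \<in> Y\<close> \<eta>(1)] Y_approx_point[OF \<open>y \<in> Y\<close> \<eta>(1)]
    unfolding cofinite_eq_sequentially
    by (intro frequently_eventually_frequently eventually_conj)
  then obtain n x' y' where n: "E \<subseteq> D n" and x': "x' \<in> frontier (D n)" "dist x x' < \<eta>"
    and y': "y' \<in> frontier (D n)" "dist y y' < \<eta>"
    by (auto dest!: frequently_ex)
  have "x' \<notin> D n" "y' \<notin> D n" using x' y' open_D[of n] by (auto simp: frontier_def interior_open)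
  have "R - s \<le> 2 * A * s"
  proof (rule cigar_connected_bounded_turning[OF open_D sc_D cigar _ \<open>compact P'\<close> \<open>compact Q'\<close> \<open>P' \<inter> Q' = {}\<close>])
    show "cball 0 R - D n \<subseteq> P' \<union> Q'"
      using n by (auto simp: E_def P'_def Q'_def)
    show "x' \<in> P' - D n"
      using x' \<open>x' \<notin> D n\<close> infdist_le[OF \<open>x \<in> P\<close>, of x'] by (auto simp: P'_def dist_commute)
    show "y' \<in> Q' - D n"
      using y' \<open>y' \<notin> D n\<close> infdist_le[OF \<open>y \<in> Q\<close>, of y'] by (auto simp: Q'_def dist_commute)
    show "norm x' \<le> s"
      using x' \<eta> \<open>norm x + 1 \<le> s\<close> norm_triangle_sub[of x' x] by (simp add: dist_norm norm_minus_commute)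
    show "norm y' \<le> s"
      using y' \<eta> \<open>norm y + 1 \<le> s\<close> norm_triangle_sub[of y' y] by (simp add: dist_norm norm_minus_commute)
  qed (use A in simp)
  then show False using \<open>R - s > 2 * A * s\<close> by simp
qed

text \<open>A connected plane set with connected complement has connected frontier. The complement
  of \<open>U\<close> is connected because each of its components contains a frontier point of
  \<open>U\<close>, and all of these lie in one component.\<close>

lemma connected_frontier_comps:
  assumes U: "U \<in> comps"
  shows "connected (frontier U)"
proof (rule connected_frontier_simple)
  note U' = comps_props[OF U]
  show "connected U" by (rule U')
  have *: "\<exists>x'\<in>frontier U. connected_component (- U) x x'" if "x \<in> - U" for x
  proof -
    let ?C = "connected_component_set (- U) x"
    have C: "?C \<in> components (- U)" using that by (rule componentsI)
    have "?C \<noteq> UNIV" using U' connected_component_subset[of "- U" x] by blast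
    moreover have "?C \<noteq> {}" using C in_components_nonempty by blast
    ultimately obtain x' where x': "x' \<in> frontier ?C" by (metis all_not_in_conv frontier_eq_empty)
    have "closed ?C" using C U'(1) by (metis closed_Compl closed_components)
    then have "x' \<in> ?C" using x' by (simp add: frontier_def)
    moreover have "x' \<in> frontier U"
      using x' frontier_of_components_subset[OF C] by (auto simp: frontier_complement)
    ultimately show ?thesis by auto
  qed
  show "connected (- U)"
    unfolding connected_iff_connected_component
    using * frontier_comps_same_component[OF U]
    by (meson connected_component_sym connected_component_trans)
qed

text \<open>The connected set \<open>frontier U\<close> lies in a single component of
  \<open>Y\<close>. As these frontiers cover \<open>Y\<close>, sending \<open>U\<close> to that
  component is onto; \<open>SOME\<close> picks an arbitrary frontier point to name it.\<close>

lemma card_components_le: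
  shows "finite (components Y) \<and> card (components Y) \<le> card comps"
proof -
  have "C \<in> (\<lambda>U. connected_component_set Y (SOME y. y \<in> frontier U)) ` comps"
    if C: "C \<in> components Y" for C
  proof -
    obtain y where "y \<in> C" using C in_components_nonempty by blast
    then have "y \<in> Y" using C in_components_subset by blast
    then obtain U where U: "U \<in> comps" "y \<in> frontier U" using Y_eq_frontiers by blast
    have "frontier U \<subseteq> C"
      using connected_frontier_comps[OF U(1)] comps_props(4)[OF U(1)] U \<open>y \<in> C\<close>
      by (intro components_maximal[OF C]) auto
    moreover have "(SOME y. y \<in> frontier U) \<in> frontier U" using U by (metis someI)
    ultimately have "C = connected_component_set Y (SOME y. y \<in> frontier U)"
      using C by (metis connected_component_eq components_iff subsetD)
    then show ?thesis using U by blast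
  qed
  then have sub: "components Y \<subseteq> (\<lambda>U. connected_component_set Y (SOME y. y \<in> frontier U)) ` comps"
    by (rule subsetI)
  have "finite comps" using card_comps by blast
  from finite_surj[OF this sub] surj_card_le[OF this sub] show ?thesis by (rule conjI)
qed

end

section \<open>Blow-ups of John domains\<close>

text \<open>The two-point chain \<open>s\<close>, \<open>t\<close> is among those in the
  supremum.\<close>

lemma dist_le_curve_length:
  assumes "a \<le> s" "s \<le> t" "t \<le> b"
  shows "ennreal (dist (\<gamma> s) (\<gamma> t)) \<le> curve_length \<gamma> a b"
proof -
  let ?f = "\<lambda>i::nat. if i = 0 then s else t"
  have "(1, ?f) \<in> {(n :: nat, t :: nat \<Rightarrow> real). mono_on {..n} t \<and> t ` {..n} \<subseteq> {a..b}}"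
    using assms by (auto simp: mono_on_def)
  then have "(case (1::nat, ?f) of (n, t) \<Rightarrow> \<Sum>i<n. ennreal (dist (\<gamma> (t i)) (\<gamma> (t (Suc i)))))
      \<le> curve_length \<gamma> a b"
    unfolding curve_length_def by (rule SUP_upper)
  then show ?thesis by simp
qed

text \<open>Chords are no longer than arcs, and the distance to the boundary is at most the distance
  to any of its points.\<close>

lemma John_domain_const_imp_cigar_connected:
  assumes "John_domain_const A D"
  shows "cigar_connected A D"
  unfolding cigar_connected_def
proof (intro ballI impI)
  fix a b assume ab: "a \<in> D" "b \<in> D" "a \<noteq> b"
  have "A \<ge> 1" using assms by (simp add: John_domain_const_def)
  obtain \<gamma> where \<gamma>: "path \<gamma>" "path_image \<gamma> \<subseteq> D" "pathstart \<gamma> = a" "pathfinish \<gamma> = b"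
    and le: "\<And>t. t \<in> {0..1} \<Longrightarrow> min (curve_length \<gamma> 0 t) (curve_length \<gamma> t 1)
                            \<le> ennreal A * dist_to_set (\<gamma> t) (frontier D)"
    using assms ab unfolding John_domain_const_def by metis
  have "min (dist w a) (dist w b) \<le> A * dist w x" if w: "w \<in> path_image \<gamma>" and x: "x \<in> frontier D" for w x
  proof -
    obtain t where t: "t \<in> {0..1}" "w = \<gamma> t" using w by (auto simp: path_image_def)
    have "ennreal (min (dist w a) (dist w b)) = min (ennreal (dist a w)) (ennreal (dist w b))"
      by (simp add: min_def dist_commute ennreal_le_iff)
    also have "\<dots> \<le> min (curve_length \<gamma> 0 t) (curve_length \<gamma> t 1)"
      using dist_le_curve_length[of 0 0 t t \<gamma>] dist_le_curve_length[of t t 1 1 \<gamma>] \<gamma> t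
      by (intro min.mono) (auto simp: pathstart_def pathfinish_def)
    also have "\<dots> \<le> ennreal A * dist_to_set w (frontier D)" using le t by simp
    also have "\<dots> \<le> ennreal A * ennreal (dist w x)"
      unfolding dist_to_set_def by (intro mult_left_mono INF_lower x) simp
    also have "\<dots> = ennreal (A * dist w x)" using \<open>A \<ge> 1\<close> by (simp add: ennreal_mult)
    finally show ?thesis using \<open>A \<ge> 1\<close> by (simp add: ennreal_le_iff)
  qed
  then show "\<exists>T. connected T \<and> T \<subseteq> D \<and> a \<in> T \<and> b \<in> T \<and>
        (\<forall>w\<in>T. \<forall>x\<in>frontier D. min (dist w a) (dist w b) \<le> A * dist w x)"
    using \<gamma> connected_path_image[of \<gamma>] pathstart_in_path_image[of \<gamma>] pathfinish_in_path_image[of \<gamma>] by metis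
qed

section \<open>Invariance under similarities\<close>

lemma blow_up_eq_scaleR: "blow_up X p r = (*\<^sub>R) (1 / r) ` ((+) (- p) ` X)"
  by (simp add: blow_up_def image_image scaleR_conv_of_real)

lemma homeomorphic_blow_up:
  assumes "r > 0"
  shows "X homeomorphic blow_up X p r"
  unfolding blow_up_def
  by (rule homeomorphicI[where f = "\<lambda>z. (z - p) / of_real r" and g = "\<lambda>w. of_real r * w + p"])
    (use assms in \<open>auto simp: image_image intro!: continuous_intros\<close>)

lemma interior_blow_up:
  assumes "r > 0"
  shows "interior (blow_up X p r) = blow_up (interior X) p r"
proof -
  have "linear ((*\<^sub>R) (1 / r) :: complex \<Rightarrow> complex)" "inj ((*\<^sub>R) (1 / r) :: complex \<Rightarrow> complex)"
    using assms by (auto simp: inj_def)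
  then show ?thesis
    unfolding blow_up_eq_scaleR by (simp only: interior_injective_linear_image interior_translation)
qed

lemma frontier_blow_up:
  assumes "r > 0"
  shows "frontier (blow_up X p r) = blow_up (frontier X) p r"
proof -
  have "closure (blow_up X p r) = blow_up (closure X) p r"
    unfolding blow_up_eq_scaleR by (simp only: closure_translation flip: closure_scaleR)
  moreover have "inj (\<lambda>z. (z - p) / complex_of_real r)" using assms by (auto simp: inj_def)
  ultimately show ?thesis
    by (simp add: frontier_def interior_blow_up[OF assms]) (simp add: blow_up_def image_set_diff)
qed

lemma open_blow_up:
  assumes "r > 0" "open X"
  shows "open (blow_up X p r)"
  using interior_blow_up[OF assms(1)] assms(2) by (metis interior_open open_interior)

lemma bounded_blow_up:
  assumes "bounded X"
  shows "bounded (blow_up X p r)"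
  unfolding blow_up_eq_scaleR using assms by (intro bounded_scaling bounded_translation)

lemma dist_blow_up: "r > 0 \<Longrightarrow> dist ((a - p) / of_real r) ((b - p) / of_real r) = dist a b / r" for a b p :: complex
  by (simp add: dist_norm norm_divide flip: diff_divide_distrib)

text \<open>Both sides of the inequality are divided by \<open>r\<close>, so \<open>A\<close> does
  not change.\<close>

lemma cigar_connected_blow_up:
  assumes "cigar_connected A D" "r > 0"
  shows "cigar_connected A (blow_up D p r)"
  unfolding cigar_connected_def
proof (intro ballI impI)
  define f where "f = (\<lambda>z. (z - p) / complex_of_real r)"
  have blow: "blow_up X p r = f ` X" for X by (simp add: blow_up_def f_def)
  fix a' b' assume "a' \<in> blow_up D p r" "b' \<in> blow_up D p r" "a' \<noteq> b'"
  then obtain a b where ab: "a' = f a" "b' = f b" "a \<in> D" "b \<in> D" "a \<noteq> b" by (auto simp: blow)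
  then obtain T where T: "connected T" "T \<subseteq> D" "a \<in> T" "b \<in> T"
     "\<And>w x. \<lbrakk>w \<in> T; x \<in> frontier D\<rbrakk> \<Longrightarrow> min (dist w a) (dist w b) \<le> A * dist w x"
    using assms(1) unfolding cigar_connected_def by metis
  have fd: "dist (f u) (f v) = dist u v / r" for u v
    using dist_blow_up[OF \<open>r > 0\<close>] by (simp add: f_def)
  show "\<exists>T. connected T \<and> T \<subseteq> blow_up D p r \<and> a' \<in> T \<and> b' \<in> T \<and>
      (\<forall>w\<in>T. \<forall>x\<in>frontier (blow_up D p r). min (dist w a') (dist w b') \<le> A * dist w x)"
  proof (intro exI[of _ "f ` T"] conjI ballI)
    have "continuous_on T f" unfolding f_def using \<open>r > 0\<close> by (intro continuous_intros) auto
    then show "connected (f ` T)" using T(1) by (rule connected_continuous_image)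
    fix w' x' assume "w' \<in> f ` T" "x' \<in> frontier (blow_up D p r)"
    then have "w' \<in> f ` T" "x' \<in> f ` frontier D"
      by (simp_all only: frontier_blow_up[OF \<open>r > 0\<close>] flip: blow)
    then obtain w x where "w' = f w" "x' = f x" "w \<in> T" "x \<in> frontier D"
      by blast
    moreover from this have "min (dist w a) (dist w b) / r \<le> A * dist w x / r"
      using T(5) \<open>r > 0\<close> by (intro divide_right_mono) auto
    ultimately show "min (dist w' a') (dist w' b') \<le> A * dist w' x'"
      using \<open>r > 0\<close> by (simp add: ab fd min_divide_distrib_right)
  qed (use T ab in \<open>auto simp: blow\<close>)
qed

lemma cigar_limit_blow_up:
  assumes "bounded D" "simply_connected D" and John: "John_domain_const A D"
    and tangent: "weak_tangent_along (frontier D) p r Y"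
  shows "cigar_limit (\<lambda>n. blow_up D (p n) (r n)) A Y"
proof
  have r: "r n > 0" and p: "p n \<in> frontier D" for n
    using tangent by (auto simp: weak_tangent_along_def)
  have "r \<longlonglongrightarrow> 0" using tangent by (simp add: weak_tangent_along_def)
  have lim: "local_Hausdorff_lim (\<lambda>n. blow_up (frontier D) (p n) (r n)) Y"
    using tangent by (simp add: weak_tangent_along_def)
  have D: "open D" "D \<noteq> {}" "A \<ge> 1"
    using John by (auto simp: John_domain_const_def plane_domain_def)
  show "A \<ge> 1" by (rule D)
  show "open (blow_up D (p n) (r n))" for n using open_blow_up D r by blast
  show "simply_connected (blow_up D (p n) (r n))" for n
    using homeomorphic_simply_connected[OF homeomorphic_blow_up] assms(2) r by blast
  show "bounded (blow_up D (p n) (r n))" for n using bounded_blow_up assms(1) by blast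
  show "cigar_connected A (blow_up D (p n) (r n))" for n
    using cigar_connected_blow_up John_domain_const_imp_cigar_connected John r by blast
  show "closed Y" using lim by (simp add: local_Hausdorff_lim_def)
  show "local_Hausdorff_lim (\<lambda>n. frontier (blow_up D (p n) (r n))) Y"
    using lim by (simp add: frontier_blow_up r)
  show "Y \<noteq> {}"
  proof -
    have "\<forall>R>0. \<forall>\<epsilon>>0. \<exists>N. \<forall>n\<ge>N.
        blow_up (frontier D) (p n) (r n) \<inter> ball 0 (R - \<epsilon>) \<subseteq> open_nbhd \<epsilon> (Y \<inter> ball 0 R)"
      using lim unfolding local_Hausdorff_lim_def by meson
    then obtain N where
      "blow_up (frontier D) (p N) (r N) \<inter> ball 0 (2 - 1) \<subseteq> open_nbhd 1 (Y \<inter> ball 0 2)"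
      using zero_less_one zero_less_numeral order_refl by meson
    \<comment> \<open>The base point \<open>p N\<close> lies on the boundary and is sent to
      0.\<close>
    moreover have "0 \<in> blow_up (frontier D) (p N) (r N)"
      unfolding blow_up_def using p by (intro image_eqI[of _ _ "p N"]) auto
    ultimately have "0 \<in> open_nbhd 1 (Y \<inter> ball 0 2)" by auto
    then show ?thesis by (auto simp: open_nbhd_def)
  qed
  show "eventually (\<lambda>n. \<exists>b\<in>blow_up D (p n) (r n). M < norm b) sequentially" for M
  proof -
    obtain a b where ab: "a \<in> D" "b \<in> D" "a \<noteq> b"
    proof -
      obtain a where "a \<in> D" using D by blast
      then have "\<not> D \<subseteq> {a}" using D not_open_singleton[of a] by (metis subset_singletonD)
      then show thesis using that \<open>a \<in> D\<close> by blast
    qed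
    \<comment> \<open>Chosen so that \<open>r n < m\<close> gives
      \<open>dist a b / 2 / r n > \<bar>M\<bar> + 1\<close>.\<close>
    define m where "m = dist a b / (2 * (\<bar>M\<bar> + 1))"
    have "m > 0" using ab by (simp add: m_def)
    then have "eventually (\<lambda>n. r n < m) sequentially"
      using \<open>r \<longlonglongrightarrow> 0\<close> order_tendstoD(2) by blast
    then show ?thesis
    proof eventually_elim
      case (elim n)
      have "M < \<bar>M\<bar> + 1" by simp
      also have "\<dots> < dist a b / 2 / r n"
        using elim r[of n] by (simp add: m_def field_simps)
      finally have M: "M < dist a b / 2 / r n" .
      \<comment> \<open>The base point varies with \<open>n\<close>, but it cannot be closer than
        \<open>dist a b / 2\<close> to both \<open>a\<close> and \<open>b\<close>.\<close>
      obtain c where c: "c \<in> D" "dist a b / 2 \<le> norm (c - p n)"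
      proof (cases "dist a b / 2 \<le> norm (a - p n)")
        case False
        then have "dist a b / 2 \<le> norm (b - p n)"
          using norm_triangle_ineq4[of "a - p n" "b - p n"] by (simp add: dist_norm)
        then show thesis using that ab by blast
      qed (use that ab in blast)
      then have "dist a b / 2 / r n \<le> norm (c - p n) / r n"
        using r[of n] by (intro divide_right_mono) auto
      with M have "M < norm ((c - p n) / of_real (r n))" using r[of n] by (simp add: norm_divide)
      then show ?case using c(1) unfolding blow_up_def by blast
    qed
  qed
qed

theorem theorem1p5:
  shows "\<exists>(K :: real \<Rightarrow> nat) (L :: real \<Rightarrow> nat).
    \<forall>(D :: complex set) (p :: nat \<Rightarrow> complex) (r :: nat \<Rightarrow> real) (Y :: complex set).
      bounded D \<and> simply_connected D \<and> John_domain D \<and>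
      weak_tangent_along (frontier D) p r Y \<longrightarrow>
        (\<forall>U \<in> D_components D p r Y. \<not> bounded U \<and> simply_connected U) \<and>
        (\<forall>C \<in> components Y. \<not> bounded C) \<and>
        Y = (\<Union>U \<in> D_components D p r Y. frontier U) \<and>
        (finite (D_components D p r Y) \<and>
          (\<forall>A. John_domain_const A D \<longrightarrow> card (D_components D p r Y) \<le> K A)) \<and>
        (finite (components Y) \<and>
          (\<forall>A. John_domain_const A D \<longrightarrow> card (components Y) \<le> L A))"
proof (intro exI[of _ "\<lambda>A. nat \<lfloor>64 * A\<^sup>2\<rfloor>"] allI impI)
  fix D :: "complex set" and p :: "nat \<Rightarrow> complex" and r :: "nat \<Rightarrow> real" and Y :: "complex set"
  assume *: "bounded D \<and> simply_connected D \<and> John_domain D \<and> weak_tangent_along (frontier D) p r Y"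
  let ?D = "\<lambda>n. blow_up D (p n) (r n)"
  \<comment> \<open>Stated for every John constant of \<open>D\<close>, since the bounds are claimed
    for all of them; \<open>comps\<close> itself does not depend on the constant.\<close>
  have limit: "cigar_limit ?D A Y" if "John_domain_const A D" for A
    using cigar_limit_blow_up that * by blast
  have comps: "cigar_limit.comps ?D Y = D_components D p r Y" if "John_domain_const A D" for A
    unfolding cigar_limit.comps_def[OF limit[OF that]] D_components_def ..
  obtain A where "John_domain_const A D" using * by (auto simp: John_domain_def)
  then interpret cigar_limit ?D A Y by (rule limit)
  note comps_A = comps[OF \<open>John_domain_const A D\<close>]
  have "card (D_components D p r Y) \<le> nat \<lfloor>64 * B\<^sup>2\<rfloor>" if "John_domain_const B D" for B
    using cigar_limit.card_comps[OF limit[OF that]] comps[OF that] by simp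
  moreover have "card (components Y) \<le> card (D_components D p r Y)"
    using card_components_le by (simp add: comps_A)
  ultimately show "(\<forall>U \<in> D_components D p r Y. \<not> bounded U \<and> simply_connected U) \<and>
        (\<forall>C \<in> components Y. \<not> bounded C) \<and>
        Y = (\<Union>U \<in> D_components D p r Y. frontier U) \<and>
        (finite (D_components D p r Y) \<and>
          (\<forall>A. John_domain_const A D \<longrightarrow> card (D_components D p r Y) \<le> nat \<lfloor>64 * A\<^sup>2\<rfloor>)) \<and>
        (finite (components Y) \<and>
          (\<forall>A. John_domain_const A D \<longrightarrow> card (components Y) \<le> nat \<lfloor>64 * A\<^sup>2\<rfloor>))"
    using comps_unbounded comps_simply_connected component_unbounded Y_eq_frontiers card_comps
      card_components_le unfolding comps_A by (meson order_trans)
qed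

end
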